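(* Let $1<p<N$ and let $f$ satisfy (H1)–(H6) (listed in the context). Then there is a positive constant $C$ independent of $\lambda$ such that for all sufficiently large $\lambda$, both $r_\lambda(0)$ and $N(\lambda)$ are bounded below by $$C\left(\frac{\lambda^{\frac{N(p-1)}{N-p}}}{f(\lambda)}\right)^{\frac{N-p}{p(N-1)}}.$$ In particular, if $\lim_{\lambda\to\infty}\frac{\lambda^{\frac{N(p-1)}{N-p}}}{f(\lambda)}=\infty$, then $r_\lambda(0)\to\infty$ and $N(\lambda)\to\infty$ as $\lambda\to\infty$.
   Context: $N$ is an integer and $p$ is real; $p'=p/(p-1)$. $\phi_p(s)=|s|^{p-2}s$ for $s\ne0$, $\phi_p(0)=0$. $F(u)=\int_0^u f(s)\,ds$. Assumptions on $f$: (H1) $f$ is continuous on $\mathbb R$, locally Lipschitz on $\mathbb R\setminus\{0\}$, with $f(0)=0$. (H2) There exist constants $a>0$ and $b<0$ such that $f$ is strictly decreasing on $(b,a)$, and $a$ (resp. $b$) is a local minimum (resp. local maximum) of $f$. (H3) $u\mapsto|F(u)|^{-1/p}$ is locally integrable near $0$; more generally, $u\mapsto|F(x_0)-F(u)|^{-1/p}$ is locally integrable near $x_0\neq0$ whenever $x_0$ is a local maximum of $F$. (H4) For any $u_0\neq0$ such that $f(u_0)=0$, $F(u_0)<0$. (H5) $f$ is nondecreasing for large values of $u$ and $\liminf_{|u|\to\infty}\frac{f(u)}{|u|^{p-2}u}=\infty$. (H6) For some $\theta\in(0,1)$, $\liminf_{|x|\to\infty}\frac{F(\theta x)}{x f(x)}>\frac{N-p}{Np}>0$.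 These assumptions give constants $B<0<A$ such that $F<0$ on $(B,A)\setminus\{0\}$, $F(A)=F(B)=0$, $f>0$ on $(A,\infty)$ and $f<0$ on $(-\infty,B)$. For $\lambda>A$, $u_\lambda$ denotes a solution of $\left(r^{N-1}\phi_p(u')\right)'+r^{N-1}f(u)=0$ for $r>0$, $u(0)=\lambda$, $u'(0)=0$, i.e. a function in $C^1([0,\infty))$ with $|u_\lambda'|^{p-2}u_\lambda'\in C^1(0,\infty)$ satisfying these conditions. The energy is $E_\lambda(r)=\frac{|u_\lambda'(r)|^p}{p'}+F(u_\lambda(r))$, and $r_\lambda(0)=\inf\{r\ge0:E_\lambda(r)=0\}$, which is finite. $N(\lambda)$ is the number of nodes of $u_\lambda$ in $[0,r_\lambda(0))$, where nodes are zeros contained in the interior of the support of the solution at which the solution changes sign. *)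

theory Defs
  imports "HOL-Analysis.Analysis"
begin

definition phi :: "real \<Rightarrow> real \<Rightarrow> real" where
  "phi p s = \<bar>s\<bar> powr (p - 2) * s"

definition primitive :: "(real \<Rightarrow> real) \<Rightarrow> real \<Rightarrow> real" where
  "primitive f u = (LBINT s=0..ereal u. f s)"

text \<open>As \<open>inverse 0 = \<infinity>\<close> in \<^typ>\<open>ennreal\<close>, the integrand below is infinite where
  \<open>g\<close> vanishes; with \<open>powr (- 1 / p)\<close> on the reals it would be \<open>0\<close> there instead, and
  a function \<open>g\<close> vanishing around \<open>x0\<close> would wrongly pass.\<close>

definition locally_integrable_inverse_root ::
    "real \<Rightarrow> (real \<Rightarrow> real) \<Rightarrow> real \<Rightarrow> bool" where
  "locally_integrable_inverse_root p g x0 \<longleftrightarrow>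
     g \<in> borel_measurable borel \<and>
     (\<exists>e>0. (\<integral>\<^sup>+u\<in>{x0 - e<..<x0 + e}. inverse (ennreal (\<bar>g u\<bar> powr (1 / p))) \<partial>lborel) < \<infinity>)"

text \<open>Derivative of a function on \<open>[0, \<infinity>)\<close>, one-sided at \<open>0\<close>; the values on the negative
  axis play no role.\<close>

definition rderiv :: "(real \<Rightarrow> real) \<Rightarrow> real \<Rightarrow> real" where
  "rderiv u r = vector_derivative u (at r within {0..})"

definition radial_solution ::
    "nat \<Rightarrow> real \<Rightarrow> (real \<Rightarrow> real) \<Rightarrow> real \<Rightarrow> (real \<Rightarrow> real) \<Rightarrow> bool" where
  "radial_solution N p f l u \<longleftrightarrow>
     u differentiable_on {0..} \<and> continuous_on {0..} (rderiv u) \<and>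
     (\<lambda>r. phi p (rderiv u r)) C1_differentiable_on {0<..} \<and>
     (\<forall>r>0. ((\<lambda>s. s ^ (N - 1) * phi p (rderiv u s)) has_real_derivative
               - (r ^ (N - 1) * f (u r))) (at r)) \<and>
     u 0 = l \<and> rderiv u 0 = 0"

definition energy :: "real \<Rightarrow> (real \<Rightarrow> real) \<Rightarrow> (real \<Rightarrow> real) \<Rightarrow> real \<Rightarrow> real" where
  "energy p f u r = \<bar>rderiv u r\<bar> powr p / (p / (p - 1)) + primitive f (u r)"

text \<open>The infimum is taken in \<^typ>\<open>ereal\<close>, so that it would be \<open>\<infinity>\<close>, not an
  unspecified real, if the energy had no zero.\<close>

definition zero_energy_radius :: "real \<Rightarrow> (real \<Rightarrow> real) \<Rightarrow> (real \<Rightarrow> real) \<Rightarrow> ereal" where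
  "zero_energy_radius p f u = Inf {ereal r | r. 0 \<le> r \<and> energy p f u r = 0}"

definition changes_sign_at :: "(real \<Rightarrow> real) \<Rightarrow> real \<Rightarrow> bool" where
  "changes_sign_at u z \<longleftrightarrow>
     (\<forall>\<^sub>F r in at_left z. u r < 0) \<and> (\<forall>\<^sub>F r in at_right z. u r > 0) \<or>
     (\<forall>\<^sub>F r in at_left z. u r > 0) \<and> (\<forall>\<^sub>F r in at_right z. u r < 0)"

definition nodes :: "(real \<Rightarrow> real) \<Rightarrow> real set" where
  "nodes u = {z. z \<in> interior (closure {r. 0 \<le> r \<and> u r \<noteq> 0}) \<and> u z = 0 \<and> changes_sign_at u z}"

definition node_count :: "real \<Rightarrow> (real \<Rightarrow> real) \<Rightarrow> (real \<Rightarrow> real) \<Rightarrow> ereal" where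
  "node_count p f u =
     (let Z = {z \<in> nodes u. 0 \<le> z \<and> ereal z < zero_energy_radius p f u}
      in if finite Z then ereal (real (card Z)) else \<infinity>)"

end

theory Submission
  imports Defs
begin

text \<open>Write \<open>F\<close> for the primitive of \<open>f\<close>, \<open>v = u'\<close>, \<open>w = phi p v\<close> and
\<open>E = \<bar>v\<bar>\<^sup>p / p' + F(u)\<close>.

\<^bold>\<open>The energy stays positive for a long time.\<close> As long as \<open>u\<close> lies in \<open>[\<theta> l, l]\<close>, the
monotonicity of \<open>f\<close> gives \<open>-w \<le> f(l) r / N\<close>, so that \<open>u\<close> stays in this range at least up to
\<open>R = (((1 - \<theta>) l)\<^bsup>p-1\<^esup> / f(l))\<^bsup>1/p\<^esup>\<close>. The Pohozaev function
\<open>P = r\<^sup>N E + (N - p)/p r\<^bsup>N-1\<^esup> w u\<close> satisfies \<open>P' = r\<^bsup>N-1\<^esup> (N F(u) - (N - p)/p u f(u))\<close>. By the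
subcriticality of \<open>f\<close>, the bracket is at least a positive multiple of \<open>l f(l)\<close> on \<open>[0, R]\<close> and is
bounded below everywhere. Where \<open>E\<close> vanishes, \<open>F(u) \<le> 0\<close>, so \<open>u\<close> and \<open>w\<close> are bounded
independently of \<open>l\<close>. Comparing the two estimates of \<open>P\<close> at a zero \<open>r\<close> of the energy yields
\<open>c l f(l) R\<^sup>N \<le> C1 r\<^bsup>N-1\<^esup> + C0 r\<^sup>N\<close>, hence, for large \<open>l\<close>, \<open>r \<ge> c rho(l)\<close> with
\<open>rho(l) = (l\<^bsup>Np/(N-p)-1\<^esup> / f(l))\<^bsup>(N-p)/(Np)\<^esup>\<close> (lemma \<open>energy_positive\<close>). Subcriticality also
forces \<open>f\<close> to grow more slowly than the critical power, so \<open>rho(l)\<close> tends to infinity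
(\<open>rho_at_top\<close>), and \<open>rho(l)\<close> dominates the quantity in the theorem (\<open>bound_le_rho\<close>).

\<^bold>\<open>While the energy is positive, zeros recur.\<close> There are \<open>T\<close> and \<open>s\<close>, not depending on the
solution, such that \<open>u\<close> has a zero in every interval of length \<open>T\<close> beyond \<open>s\<close> on which \<open>E > 0\<close>
(lemma \<open>oscillation\<close>). Up to reflection let \<open>u > 0\<close>. In a range \<open>(0, A]\<close> where \<open>F < 0\<close>, positivity of
the energy gives \<open>\<bar>v\<bar> \<ge> \<bar>F(u)\<bar>\<^bsup>1/p\<^esup>\<close>, and the time spent there is bounded by a multiple of the integral
of \<open>\<bar>F\<bar>\<^bsup>-1/p\<^esup>\<close>, which is finite. Above \<open>A\<close> one has \<open>f(u) \<ge> c u\<^bsup>p-1\<^esup>\<close>, and the equation pulls \<open>u\<close> down to \<open>A\<close>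
within a bounded time. Zeros with positive energy are simple, hence nodes, and counting those in
disjoint intervals inside \<open>[0, c rho(l))\<close> gives a number of nodes of order \<open>rho(l)\<close>.\<close>

section \<open>The function phi\<close>

lemma phi_zero_less_iff: "0 < phi p s \<longleftrightarrow> 0 < s"
  by (cases "s = 0") (auto simp: phi_def zero_less_mult_iff)

lemma phi_less_zero_iff: "phi p s < 0 \<longleftrightarrow> s < 0"
  by (cases "s = 0") (auto simp: phi_def mult_less_0_iff)

lemma phi_minus: "phi p (- s) = - phi p s"
  by (simp add: phi_def)

lemma abs_phi: "\<bar>phi p s\<bar> = \<bar>s\<bar> powr (p - 1)"
proof (cases "s = 0")
  case False
  then show ?thesis
    using powr_mult_base[of "\<bar>s\<bar>" "p - 2"] by (simp add: phi_def abs_mult mult.commute)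
qed (simp add: phi_def)

lemma phi_nonneg_eq: "0 \<le> s \<Longrightarrow> phi p s = s powr (p - 1)"
  using abs_phi[of p s] phi_less_zero_iff[of p s] by auto

lemma mult_phi: "s * phi p s = \<bar>s\<bar> powr p"
proof (cases "s = 0")
  case False
  have "s * phi p s = \<bar>s\<bar> * (\<bar>s\<bar> * \<bar>s\<bar> powr (p - 2))"
    by (simp add: phi_def flip: mult.assoc)
  also have "\<dots> = \<bar>s\<bar> powr p"
    using powr_mult_base[of "\<bar>s\<bar>" "p - 2"] powr_mult_base[of "\<bar>s\<bar>" "p - 1"]
    by simp
  finally show ?thesis .
qed (simp add: phi_def)

text \<open>The inverse of \<open>phi p\<close> is \<open>phi p'\<close> with the conjugate exponent \<open>p' = p / (p - 1)\<close>.\<close>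

lemma phi_conjugate:
  assumes "1 < p"
  shows "phi (p / (p - 1)) (phi p s) = s"
proof (cases "s = 0")
  case False
  have e: "(p - 1) * (p / (p - 1) - 2) + (p - 2) = 0"
    using assms by (simp add: field_simps)
  have "phi (p / (p - 1)) (phi p s) = \<bar>s\<bar> powr ((p - 1) * (p / (p - 1) - 2)) * \<bar>s\<bar> powr (p - 2) * s"
    unfolding phi_def[of "p / (p - 1)"] abs_phi by (simp add: phi_def powr_powr)
  also have "\<dots> = \<bar>s\<bar> powr ((p - 1) * (p / (p - 1) - 2) + (p - 2)) * s"
    by (simp add: powr_add)
  finally show ?thesis using False by (simp add: e)
qed (simp add: phi_def)

lemma continuous_on_phi:
  assumes "1 < p"
  shows "continuous_on S (phi p)"
proof -
  have "phi p = (\<lambda>s. max s 0 powr (p - 1) - max (- s) 0 powr (p - 1))"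
  proof
    fix s
    show "phi p s = max s 0 powr (p - 1) - max (- s) 0 powr (p - 1)"
      using phi_nonneg_eq[of s p] phi_nonneg_eq[of "- s" p] by (cases "0 \<le> s") (auto simp: phi_minus max_def)
  qed
  moreover have "continuous_on S (\<lambda>s. max s 0 powr (p - 1) - max (- s) 0 powr (p - 1))"
    using assms by (intro continuous_intros continuous_on_powr') auto
  ultimately show ?thesis by simp
qed

lemma DERIV_abs_powr:
  fixes q :: real
  assumes "1 < q"
  shows "((\<lambda>x. \<bar>x\<bar> powr q) has_real_derivative q * phi q x) (at x)"
proof -
  consider "x > 0" | "x < 0" | "x = 0" by linarith
  then show ?thesis
  proof cases
    case 1
    have "((\<lambda>x. x powr q) has_real_derivative q * x powr (q - 1)) (at x)"
      using 1 by (auto intro!: derivative_eq_intros)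
    moreover have "eventually (\<lambda>y. y powr q = \<bar>y\<bar> powr q) (nhds x)"
      using eventually_nhds_in_open[of "{0<..}" x] 1 by (auto elim!: eventually_mono)
    ultimately show ?thesis
      using 1 DERIV_cong_ev[of x x "\<lambda>x. x powr q" "\<lambda>x. \<bar>x\<bar> powr q"] by (simp add: phi_nonneg_eq)
  next
    case 2
    have "((\<lambda>x. (-x) powr q) has_real_derivative q * (- ((-x) powr (q - 1)))) (at x)"
      using 2 by (auto intro!: derivative_eq_intros)
    moreover have "eventually (\<lambda>y. (-y) powr q = \<bar>y\<bar> powr q) (nhds x)"
      using eventually_nhds_in_open[of "{..<0}" x] 2 by (auto elim!: eventually_mono)
    moreover have "phi q x = - ((-x) powr (q - 1))"
      using phi_nonneg_eq[of "-x" q] 2 by (simp add: phi_minus)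
    ultimately show ?thesis
      using DERIV_cong_ev[of x x "\<lambda>x. (-x) powr q" "\<lambda>x. \<bar>x\<bar> powr q"] by simp
  next
    case 3
    have "((\<lambda>y. phi q y) \<longlongrightarrow> phi q 0) (at 0)"
      using continuous_on_phi[OF assms, of UNIV] by (simp add: continuous_on_def)
    moreover have "\<forall>\<^sub>F y in at 0. phi q y = (\<bar>y\<bar> powr q - \<bar>0\<bar> powr q) / (y - 0)"
      using mult_phi[of _ q] by (auto simp: eventually_at_filter field_simps)
    ultimately have "((\<lambda>y. (\<bar>y\<bar> powr q - \<bar>0\<bar> powr q) / (y - 0)) \<longlongrightarrow> phi q 0) (at 0)"
      using tendsto_cong by force
    then show ?thesis
      using 3 by (simp add: has_field_derivative_iff phi_def)
  qed
qed

section \<open>Radial solutions\<close>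

text \<open>The differential equation on \<open>(0, \<infinity>)\<close> alone, for the pair of a solution \<open>u\<close> and its derivative \<open>v\<close>.
Initial values are left out, and \<open>f\<close> is arbitrary, so that the notion is invariant under the
reflection \<open>u \<mapsto> - u\<close>, \<open>f \<mapsto> - f (- _)\<close>.\<close>

definition radial_flow ::
    "nat \<Rightarrow> real \<Rightarrow> (real \<Rightarrow> real) \<Rightarrow> (real \<Rightarrow> real) \<Rightarrow> (real \<Rightarrow> real) \<Rightarrow> bool" where
  "radial_flow N p f u v \<longleftrightarrow>
     continuous_on {0<..} v \<and>
     (\<forall>r>0. (u has_real_derivative v r) (at r) \<and>
        ((\<lambda>s. s ^ (N - 1) * phi p (v s)) has_real_derivative - (r ^ (N - 1) * f (u r))) (at r))"

lemma radial_solution_flow: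
  assumes "radial_solution N p f l u"
  shows "radial_flow N p f u (rderiv u)" "continuous_on {0..} u" "continuous_on {0..} (rderiv u)"
    "u 0 = l" "rderiv u 0 = 0"
proof -
  have d: "u differentiable_on {0..}" and w: "\<forall>r>0. ((\<lambda>s. s ^ (N - 1) * phi p (rderiv u s)) has_real_derivative
               - (r ^ (N - 1) * f (u r))) (at r)"
    using assms by (auto simp: radial_solution_def)
  have "(u has_real_derivative rderiv u r) (at r)" if "r > 0" for r
  proof -
    have "(u has_vector_derivative rderiv u r) (at r within {0..})"
      using d that by (auto simp: differentiable_on_def rderiv_def vector_derivative_works)
    moreover have "at r within {0..} = at r"
      using that by (intro at_within_interior) (auto simp: interior_real_atLeast)
    ultimately show ?thesis by (simp add: has_real_derivative_iff_has_vector_derivative)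
  qed
  moreover have "continuous_on {0<..} (rderiv u)"
    using assms unfolding radial_solution_def by (meson continuous_on_subset greaterThan_subset_iff
        greaterThan_iff less_imp_le atLeast_iff subsetI)
  ultimately show "radial_flow N p f u (rderiv u)" using w by (auto simp: radial_flow_def)
  show "continuous_on {0..} u" using d by (rule differentiable_imp_continuous_on)
qed (use assms in \<open>auto simp: radial_solution_def\<close>)

lemma radial_flow_minus:
  assumes "radial_flow N p f u v"
  shows "radial_flow N p (\<lambda>x. - f (- x)) (\<lambda>r. - u r) (\<lambda>r. - v r)"
  unfolding radial_flow_def
proof (intro allI impI conjI)
  show "continuous_on {0<..} (\<lambda>r. - v r)"
    using assms by (auto simp: radial_flow_def intro: continuous_on_minus)
next
  fix r :: real assume r: "r > 0"
  from assms r have 1: "(u has_real_derivative v r) (at r)" and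
    2: "((\<lambda>s. s ^ (N - 1) * phi p (v s)) has_real_derivative - (r ^ (N - 1) * f (u r))) (at r)"
    by (auto simp: radial_flow_def)
  show "((\<lambda>r. - u r) has_real_derivative - v r) (at r)" using DERIV_minus[OF 1] .
  show "((\<lambda>s. s ^ (N - 1) * phi p (- v s)) has_real_derivative
         - (r ^ (N - 1) * - f (- (- u r)))) (at r)"
    using DERIV_minus[OF 2] by (simp add: phi_minus)
qed

lemma radial_flow_continuous:
  assumes "radial_flow N p f u v" "S \<subseteq> {0<..}"
  shows "continuous_on S u"
  using assms by (auto simp: radial_flow_def continuous_on_eq_continuous_within
      intro!: continuous_at_imp_continuous_at_within DERIV_isCont)

section \<open>The Pohozaev identity\<close>

text \<open>The function differentiated is \<open>r\<^sup>N E(r) + (N - p)/p r\<^bsup>N-1\<^esup> w u\<close> with \<open>w = phi p v\<close>. Although \<open>v\<close> itself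
need not be differentiable, \<open>\<bar>v\<bar>\<^sup>p = \<bar>w\<bar>\<^bsup>p'\<^esup>\<close> is, as a function of the differentiable \<open>w\<close>. All terms in
\<open>\<bar>v\<bar>\<^sup>p\<close> cancel.\<close>

lemma DERIV_Pohozaev:
  assumes "1 < p" "0 < N" and flow: "radial_flow N p f u v"
    and F: "\<And>x. (F has_real_derivative f x) (at x)" and r: "r > 0"
  shows "((\<lambda>r. r ^ N * (\<bar>v r\<bar> powr p / (p / (p - 1)) + F (u r))
              + (real N - p) / p * (r ^ (N - 1) * phi p (v r)) * u r) has_real_derivative
          r ^ (N - 1) * (real N * F (u r) - (real N - p) / p * (u r * f (u r)))) (at r)"
proof -
  let ?q = "p / (p - 1)"
  have q: "?q > 1" using assms by (simp add: field_simps)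
  from flow r have du: "(u has_real_derivative v r) (at r)" and
    dw: "((\<lambda>s. s ^ (N - 1) * phi p (v s)) has_real_derivative - (r ^ (N - 1) * f (u r))) (at r)"
    by (auto simp: radial_flow_def)
  define W where "W = - f (u r) - (real N - 1) / r * phi p (v r)"
  have dphi: "((\<lambda>s. phi p (v s)) has_real_derivative W) (at r)"
  proof -
    have "((\<lambda>s. s ^ (N - 1) * phi p (v s) / s ^ (N - 1)) has_real_derivative
        (- (r ^ (N - 1) * f (u r)) * r ^ (N - 1) - (r ^ (N - 1) * phi p (v r)) * (real (N - 1) * r ^ (N - 1 - 1)))
         / (r ^ (N - 1) * r ^ (N - 1))) (at r)"
      using r by (intro DERIV_divide dw) (auto intro!: derivative_eq_intros)
    moreover have "(- (r ^ (N - 1) * f (u r)) * r ^ (N - 1) - (r ^ (N - 1) * phi p (v r)) * (real (N - 1) * r ^ (N - 1 - 1)))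
         / (r ^ (N - 1) * r ^ (N - 1)) = W"
    proof (cases "N = 1")
      case True then show ?thesis using r by (simp add: W_def)
    next
      case False
      then obtain k where k: "N = Suc (Suc k)" using assms(2)
        by (metis One_nat_def gr0_implies_Suc neq0_conv)
      show ?thesis using r unfolding W_def k by (simp add: field_simps)
    qed
    moreover have "eventually (\<lambda>s. s ^ (N - 1) * phi p (v s) / s ^ (N - 1) = phi p (v s)) (nhds r)"
      by (rule eventually_mono[OF eventually_nhds_in_open[of "{0<..}" r]]) (use r in auto)
    ultimately show ?thesis
      using DERIV_cong_ev[of r r "\<lambda>s. s ^ (N - 1) * phi p (v s) / s ^ (N - 1)" "\<lambda>s. phi p (v s)"] by simp
  qed
  have eq: "\<bar>phi p (v s)\<bar> powr ?q = \<bar>v s\<bar> powr p" for s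
    using assms(1) by (simp add: abs_phi powr_powr)
  have "((\<lambda>s. \<bar>phi p (v s)\<bar> powr ?q) has_real_derivative ?q * phi ?q (phi p (v r)) * W) (at r)"
    using DERIV_chain2[OF DERIV_abs_powr[OF q] dphi] .
  then have dv: "((\<lambda>s. \<bar>v s\<bar> powr p) has_real_derivative ?q * v r * W) (at r)"
    by (simp add: eq phi_conjugate[OF assms(1)])
  have dF: "((\<lambda>s. F (u s)) has_real_derivative f (u r) * v r) (at r)"
    using DERIV_chain2[OF F du] .
  have "((\<lambda>r. r ^ N * (\<bar>v r\<bar> powr p / ?q + F (u r))
              + (real N - p) / p * (r ^ (N - 1) * phi p (v r)) * u r) has_real_derivative
     (real N * r ^ (N - 1)) * (\<bar>v r\<bar> powr p / ?q + F (u r)) + (?q * v r * W / ?q + f (u r) * v r) * r ^ N +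
      ((real N - p) / p * (- (r ^ (N - 1) * f (u r))) * u r + v r * ((real N - p) / p * (r ^ (N - 1) * phi p (v r))))) (at r)"
    using q by (intro DERIV_add DERIV_mult DERIV_cmult DERIV_cdivide dv dF dw du)
       (auto intro!: derivative_eq_intros)
  moreover have "(real N * r ^ (N - 1)) * (\<bar>v r\<bar> powr p / ?q + F (u r)) + (?q * v r * W / ?q + f (u r) * v r) * r ^ N +
      ((real N - p) / p * (- (r ^ (N - 1) * f (u r))) * u r + v r * ((real N - p) / p * (r ^ (N - 1) * phi p (v r)))) =
      r ^ (N - 1) * (real N * F (u r) - (real N - p) / p * (u r * f (u r)))"
  proof -
    define V where "V = v r * phi p (v r)"
    have V: "\<bar>v r\<bar> powr p = V" by (simp add: mult_phi V_def)
    obtain k where k: "N = Suc k" using assms(2) gr0_implies_Suc by blast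
    have 1: "(?q * v r * W / ?q + f (u r) * v r) * r ^ N = - (real N - 1) * V * r ^ (N - 1)"
    proof -
      have "?q * v r * W / ?q = v r * W" using q by auto
      then show ?thesis using r by (simp only:) (simp add: W_def V_def k field_simps)
    qed
    have 2: "v r * ((real N - p) / p * (r ^ (N - 1) * phi p (v r))) = (real N - p) / p * V * r ^ (N - 1)"
      by (simp add: V_def)
    show ?thesis unfolding 1 2 V using assms(1) by (simp add: field_simps)
  qed
  ultimately show ?thesis by simp
qed

section \<open>Time spent in a range of values\<close>

text \<open>If \<open>\<bar>u'\<bar> \<ge> g(u)\<close> and \<open>G\<close> is a bounded antiderivative of \<open>1 / g\<close>, then \<open>G(u)\<close> has slope of absolute
value at least \<open>1\<close>, which limits the time during which \<open>u\<close> can stay in the domain of \<open>G\<close>.\<close>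

lemma transit_time_bound:
  assumes G: "\<And>x. 0 < x \<Longrightarrow> x < A1 \<Longrightarrow> (G has_real_derivative 1 / g x) (at x)"
    and K: "\<And>x. 0 < x \<Longrightarrow> x < A1 \<Longrightarrow> \<bar>G x\<bar> \<le> K"
    and g: "\<And>x. 0 < x \<Longrightarrow> x < A1 \<Longrightarrow> 0 < g x"
    and ab: "a \<le> b"
    and du: "\<And>r. a \<le> r \<Longrightarrow> r \<le> b \<Longrightarrow> (u has_real_derivative v r) (at r)"
    and u: "\<And>r. a \<le> r \<Longrightarrow> r \<le> b \<Longrightarrow> 0 < u r \<and> u r < A1"
    and v: "\<And>r. a \<le> r \<Longrightarrow> r \<le> b \<Longrightarrow> g (u r) \<le> \<bar>v r\<bar>"
  shows "b - a \<le> 2 * K"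
proof (cases "a = b")
  case True
  then show ?thesis using K[of "u a"] u[of a] by force
next
  case False
  with ab have "a < b" by simp
  have "((\<lambda>r. G (u r)) has_real_derivative 1 / g (u r) * v r) (at r)" if "a \<le> r" "r \<le> b" for r
    using DERIV_chain2[OF G du] u that by blast
  from MVT2[OF \<open>a < b\<close> this] obtain z where z: "a < z" "z < b"
    and eq: "G (u b) - G (u a) = (b - a) * (1 / g (u z) * v z)" by blast
  have gz: "g (u z) > 0" "g (u z) \<le> \<bar>v z\<bar>" using g u[of z] v[of z] z by auto
  have "b - a \<le> (b - a) * (\<bar>v z\<bar> / g (u z))"
    using mult_left_mono[of 1 "\<bar>v z\<bar> / g (u z)" "b - a"] gz \<open>a < b\<close> by simp
  also have "\<dots> = \<bar>G (u b) - G (u a)\<bar>"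
    unfolding eq using gz \<open>a < b\<close> by (simp add: abs_mult)
  also have "\<dots> \<le> \<bar>G (u b)\<bar> + \<bar>G (u a)\<bar>" by (rule abs_triangle_ineq4)
  also have "\<dots> \<le> 2 * K" using K[of "u a"] K[of "u b"] u[of a] u[of b] ab by fastforce
  finally show ?thesis .
qed

section \<open>Bounded time above a level\<close>

lemma radial_flow_DERIV:
  assumes "radial_flow N p f u v" "r > 0"
  shows "(u has_real_derivative v r) (at r)"
    "((\<lambda>s. s ^ (N - 1) * phi p (v s)) has_real_derivative - (r ^ (N - 1) * f (u r))) (at r)"
  using assms by (auto simp: radial_flow_def)

text \<open>A solution that stays above a level on which \<open>f(x) \<ge> c x\<^bsup>p-1\<^esup>\<close> cannot increase for long. While it
increases, it is concave, so after one unit of time \<open>u' \<le> u\<close>; from then on \<open>r\<^bsup>N-1\<^esup> phi(u')\<close> loses at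
least \<open>r\<^bsup>N-1\<^esup> c u\<^bsup>p-1\<^esup>\<close> per unit of time and vanishes within time \<open>1 / c\<close>.\<close>

lemma superlinear_turning:
  assumes p: "1 < p" and c: "0 < c" and A: "0 < A"
    and f: "\<And>x. A \<le> x \<Longrightarrow> c * x powr (p - 1) \<le> f x"
    and flow: "radial_flow N p f u v" and s: "1 \<le> s"
    and above: "\<And>r. s \<le> r \<Longrightarrow> r \<le> s + 1 + 1 / c \<Longrightarrow> A \<le> u r"
  shows "\<exists>t\<in>{s..s + 1 + 1 / c}. v t \<le> 0"
proof (rule ccontr)
  let ?e = "s + 1 + 1 / c" and ?D = "\<lambda>r. r ^ (N - 1) * phi p (v r)"
  assume "\<not> ?thesis"
  then have v: "v r > 0" if "s \<le> r" "r \<le> ?e" for r using that by force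
  have e: "s < s + 1" "s + 1 < ?e" using c by auto
  note du = radial_flow_DERIV(1)[OF flow] and dD = radial_flow_DERIV(2)[OF flow]
  have fpos: "f (u r) > 0" if "s \<le> r" "r \<le> ?e" for r
    using f[OF above[OF that]] above[OF that] c A
    by (smt (verit, best) mult_pos_pos powr_gt_zero)
  have Ddec: "?D r' \<le> ?D r" if "s \<le> r" "r \<le> r'" "r' \<le> ?e" for r r'
  proof (rule DERIV_nonpos_imp_nonincreasing[OF that(2)])
    fix x assume x: "r \<le> x" "x \<le> r'"
    with that s have "x > 0" "f (u x) > 0" using fpos[of x] by auto
    then show "\<exists>y. (?D has_real_derivative y) (at x) \<and> y \<le> 0"
      using dD[of x] by (intro exI[of _ "- (x ^ (N - 1) * f (u x))"]) simp
  qed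
  have umono: "u r \<le> u r'" if "s \<le> r" "r \<le> r'" "r' \<le> ?e" for r r'
    by (rule DERIV_nonneg_imp_nondecreasing[OF that(2)])
      (use that s du v in \<open>meson less_eq_real_def order_trans less_le_trans zero_less_one\<close>)
  define U where "U = u (s + 1)"
  have U: "U > 0" using above[of "s + 1"] A e by (auto simp: U_def)
  have vU: "v (s + 1) \<le> U"
  proof -
    obtain z where z: "s < z" "z < s + 1" "u (s + 1) - u s = (s + 1 - s) * v z"
      using MVT2[of s "s + 1" u v] du s by auto
    have pow: "z ^ (N - 1) \<le> (s + 1) ^ (N - 1)" using z s by (intro power_mono) auto
    have "z ^ (N - 1) * phi p (v (s + 1)) \<le> ?D (s + 1)"
      using pow v[of "s + 1"] e by (intro mult_right_mono) (auto simp: phi_zero_less_iff less_imp_le)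
    also have "\<dots> \<le> ?D z" using z e by (intro Ddec) auto
    finally have "phi p (v (s + 1)) \<le> phi p (v z)" using z s by simp
    then have "v (s + 1) powr (p - 1) \<le> v z powr (p - 1)"
      using v[of z] v[of "s + 1"] z e by (simp add: phi_nonneg_eq)
    then have "v (s + 1) \<le> v z"
      using p v[of z] v[of "s + 1"] z e
      by (smt (verit, best) powr_less_mono2)
    also have "\<dots> \<le> U" using z above[of s] A e by (simp add: U_def)
    finally show ?thesis .
  qed
  have "?D ?e - ?D (s + 1) \<le> (?e - (s + 1)) * - ((s + 1) ^ (N - 1) * (c * U powr (p - 1)))"
  proof -
    obtain z where z: "s + 1 < z" "z < ?e"
      "?D ?e - ?D (s + 1) = (?e - (s + 1)) * - (z ^ (N - 1) * f (u z))"
      using MVT2[OF e(2), of ?D "\<lambda>r. - (r ^ (N - 1) * f (u r))"] dD s by auto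
    have uz: "U \<le> u z" unfolding U_def using z e by (intro umono) auto
    have "c * U powr (p - 1) \<le> c * u z powr (p - 1)"
      using uz U c p by (intro mult_left_mono powr_mono2) auto
    also have "\<dots> \<le> f (u z)" using above[of z] z e by (intro f) auto
    finally have "(s + 1) ^ (N - 1) * (c * U powr (p - 1)) \<le> z ^ (N - 1) * f (u z)"
      using z s c by (intro mult_mono power_mono) auto
    then show ?thesis unfolding z(3) using e by (intro mult_left_mono) auto
  qed
  also have "\<dots> = - ((s + 1) ^ (N - 1) * U powr (p - 1))" using c by simp
  also have "\<dots> \<le> - ?D (s + 1)"
    using s vU v[of "s + 1"] e U p
    by (auto simp: phi_nonneg_eq intro!: mult_left_mono powr_mono2)
  finally have "?D ?e \<le> 0" by simp
  moreover have "?D ?e > 0" using v[of ?e] e s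
    by (intro mult_pos_pos zero_less_power) (use c in \<open>auto simp: phi_zero_less_iff add_pos_pos\<close>)
  ultimately show False by simp
qed

text \<open>Once it has turned, such a solution leaves the range from above in bounded time, however large it
is. Within one unit of time the slope reaches \<open>- \<kappa> U\<close>, where \<open>U\<close> is the value at that moment, and
the damping cannot reduce it below this much while \<open>r\<close> at most doubles. Hence \<open>0\<close> would be
reached after the further time \<open>1 / \<kappa>\<close> at the latest. The condition \<open>1 / \<kappa> \<le> t\<close> ensures that \<open>r\<close> at most doubles.\<close>

lemma superlinear_descent:
  fixes p c :: real and N :: nat
  defines "\<kappa> \<equiv> (c / 4 ^ (N - 1)) powr (1 / (p - 1))"
  assumes p: "1 < p" and c: "0 < c" and A: "0 < A"
    and f: "\<And>x. A \<le> x \<Longrightarrow> c * x powr (p - 1) \<le> f x"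
    and flow: "radial_flow N p f u v" and t: "1 \<le> t" "1 / \<kappa> \<le> t" and vt: "v t \<le> 0"
  shows "\<exists>r\<in>{t..t + 1 + 1 / \<kappa>}. u r < A"
proof (rule ccontr)
  let ?e = "t + 1 + 1 / \<kappa>" and ?D = "\<lambda>r. r ^ (N - 1) * phi p (v r)"
  assume "\<not> ?thesis"
  then have above: "A \<le> u r" if "t \<le> r" "r \<le> ?e" for r using that by force
  have \<kappa>: "\<kappa> > 0" using c by (simp add: \<kappa>_def)
  have e: "t < t + 1" "t + 1 < ?e" using \<kappa> by auto
  note du = radial_flow_DERIV(1)[OF flow] and dD = radial_flow_DERIV(2)[OF flow]
  have fpos: "f (u r) > 0" if "t \<le> r" "r \<le> ?e" for r
    using f[OF above[OF that]] above[OF that] c A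
    by (smt (verit, best) mult_pos_pos powr_gt_zero)
  have Ddec: "?D r' \<le> ?D r" if "t \<le> r" "r \<le> r'" "r' \<le> ?e" for r r'
  proof (rule DERIV_nonpos_imp_nonincreasing[OF that(2)])
    fix x assume x: "r \<le> x" "x \<le> r'"
    with that t have "x > 0" "f (u x) > 0" using fpos[of x] by auto
    then show "\<exists>y. (?D has_real_derivative y) (at x) \<and> y \<le> 0"
      using dD[of x] by (intro exI[of _ "- (x ^ (N - 1) * f (u x))"]) simp
  qed
  have Dt: "?D t \<le> 0"
    using vt phi_zero_less_iff[of p "v t"] t by (simp add: mult_nonneg_nonpos)
  have v: "v r \<le> 0" if "t \<le> r" "r \<le> ?e" for r
  proof -
    have "?D r \<le> 0" using Ddec[of t r] Dt that by simp
    then show ?thesis using that t phi_zero_less_iff[of p "v r"]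
      by (smt (verit, best) mult_pos_pos zero_less_power)
  qed
  have udec: "u r' \<le> u r" if "t \<le> r" "r \<le> r'" "r' \<le> ?e" for r r'
    by (rule DERIV_nonpos_imp_nonincreasing[OF that(2)])
      (use that t du v in \<open>meson less_eq_real_def order_trans less_le_trans zero_less_one\<close>)
  define U where "U = u (t + 1)"
  have U: "U > 0" using above[of "t + 1"] A e by (auto simp: U_def)
  have "?D (t + 1) - ?D t \<le> - (((t + 1) / 2) ^ (N - 1) * (c * U powr (p - 1)))"
  proof -
    obtain z where z: "t < z" "z < t + 1"
      "?D (t + 1) - ?D t = (t + 1 - t) * - (z ^ (N - 1) * f (u z))"
      using MVT2[OF e(1), of ?D "\<lambda>r. - (r ^ (N - 1) * f (u r))"] dD t by auto
    have uz: "U \<le> u z" unfolding U_def using z e by (intro udec) auto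
    have "c * U powr (p - 1) \<le> c * u z powr (p - 1)"
      using uz U c p by (intro mult_left_mono powr_mono2) auto
    also have "\<dots> \<le> f (u z)" using above[of z] z e by (intro f) auto
    finally have "((t + 1) / 2) ^ (N - 1) * (c * U powr (p - 1)) \<le> z ^ (N - 1) * f (u z)"
      using z t c by (intro mult_mono power_mono) auto
    then show ?thesis unfolding z(3) by simp
  qed
  with Dt have D1: "?D (t + 1) \<le> - (((t + 1) / 2) ^ (N - 1) * (c * U powr (p - 1)))" by simp
  have fast: "v r \<le> - (\<kappa> * U)" if r: "t + 1 \<le> r" "r \<le> ?e" for r
  proof -
    have "r ^ (N - 1) \<le> (2 * (t + 1)) ^ (N - 1)" using r t by (intro power_mono) auto
    then have "(2 * (t + 1)) ^ (N - 1) * phi p (v r) \<le> ?D r"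
      using v[of r] r e phi_zero_less_iff[of p "v r"] by (intro mult_right_mono_neg) auto
    also have "\<dots> \<le> ?D (t + 1)" using r e by (intro Ddec) auto
    also note D1
    also have "- (((t + 1) / 2) ^ (N - 1) * (c * U powr (p - 1)))
        = (2 * (t + 1)) ^ (N - 1) * - (c / 4 ^ (N - 1) * U powr (p - 1))"
    proof -
      have "(2 * (t + 1)) ^ (N - 1) = ((t + 1) / 2) ^ (N - 1) * 4 ^ (N - 1)"
        unfolding power_mult_distrib[symmetric] by (rule arg_cong[where f = "\<lambda>x. x ^ (N - 1)"]) simp
      then show ?thesis by simp
    qed
    finally have "phi p (v r) \<le> - (c / 4 ^ (N - 1) * U powr (p - 1))"
      by (rule mult_left_le_imp_le) (use t in simp)
    then have "c / 4 ^ (N - 1) * U powr (p - 1) \<le> (- v r) powr (p - 1)"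
      using v[of r] r e phi_minus[of p "v r"] phi_nonneg_eq[of "- v r" p] by simp
    moreover have "c / 4 ^ (N - 1) * U powr (p - 1) = (\<kappa> * U) powr (p - 1)"
      using c U \<kappa> p by (simp add: \<kappa>_def powr_mult powr_powr)
    ultimately have "(\<kappa> * U) powr (p - 1) \<le> (- v r) powr (p - 1)" by simp
    then have "\<kappa> * U \<le> - v r"
      using p v[of r] r e \<kappa> U powr_less_mono2[of "p - 1" "- v r" "\<kappa> * U"] by force
    then show ?thesis by simp
  qed
  obtain z where z: "t + 1 < z" "z < ?e" "u ?e - u (t + 1) = (?e - (t + 1)) * v z"
    using MVT2[OF e(2), of u v] du t by auto
  have "u ?e - U \<le> (?e - (t + 1)) * - (\<kappa> * U)"
    unfolding U_def[symmetric] z(3)[unfolded U_def[symmetric]]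
    using fast[of z] z \<kappa> by (intro mult_left_mono) auto
  also have "\<dots> = - U" using \<kappa> by simp
  finally have "u ?e \<le> 0" by simp
  with above[of ?e] A e show False by auto
qed

section \<open>Oscillation while the energy is positive\<close>

lemma compact_Int_vimage:
  fixes f :: "'a::t2_space \<Rightarrow> 'b::topological_space"
  assumes "compact S" "continuous_on S f" "closed T"
  shows "compact (S \<inter> f -` T)"
proof -
  have "closed (S \<inter> f -` T)"
    using assms by (intro continuous_closed_preimage compact_imp_closed)
  then have "compact (S \<inter> (S \<inter> f -` T))" by (rule compact_Int_closed[OF assms(1)])
  then show ?thesis by (simp add: Int_absorb flip: Int_assoc)
qed

text \<open>A positive solution on a long interval would first rise above \<open>A\<close>, then descend through \<open>A\<close>, and
after that it could not turn around within \<open>(0, A)\<close>, where its slope does not vanish; so it would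
spend more than the available transit time below \<open>A\<close>.\<close>

lemma zero_from_transit_and_descent:
  fixes p c A A1 K :: real and N :: nat and f G g :: "real \<Rightarrow> real"
  assumes p: "1 < p" and c: "0 < c" and A: "0 < A" "A < A1"
    and f_ge: "\<forall>x\<ge>A. c * x powr (p - 1) \<le> f x"
    and G_bounded: "\<forall>x. 0 < x \<and> x < A1 \<longrightarrow> (G has_real_derivative 1 / g x) (at x) \<and> \<bar>G x\<bar> \<le> K"
    and g_pos: "\<forall>x. 0 < x \<and> x < A1 \<longrightarrow> 0 < g x"
  shows "\<exists>T>0. \<exists>s0\<ge>1. \<forall>u v. \<forall>s\<ge>s0. radial_flow N p f u v \<longrightarrow>
    (\<forall>r\<in>{s..s + T}. 0 < u r \<and> u r < A1 \<longrightarrow> g (u r) \<le> \<bar>v r\<bar>) \<longrightarrow> (\<exists>z\<in>{s..s + T}. u z \<le> 0)"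
proof -
  have f: "c * x powr (p - 1) \<le> f x" if "A \<le> x" for x using f_ge that by blast
  have G: "(G has_real_derivative 1 / g x) (at x)" and K: "\<bar>G x\<bar> \<le> K" and g: "0 < g x"
    if "0 < x" "x < A1" for x using G_bounded g_pos that by auto
  define \<kappa> where "\<kappa> = (c / 4 ^ (N - 1)) powr (1 / (p - 1))"
  have \<kappa>: "\<kappa> > 0" using c by (simp add: \<kappa>_def)
  define T1 where "T1 = 2 * K + 1"
  define T2 where "T2 = 1 + 1 / c"
  define T3 where "T3 = 1 + 1 / \<kappa>"
  have K0: "K \<ge> 0" using K[of A] A by auto
  have T: "T1 > 0" "T2 > 0" "T3 > 0" using K0 c \<kappa> by (auto simp: T1_def T2_def T3_def add_pos_pos)
  show ?thesis
  proof (rule exI[of _ "T1 + T2 + T3 + T1"], intro conjI exI[of _ "max 1 (1 / \<kappa>)"] allI impI)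
    fix u v s assume s: "max 1 (1 / \<kappa>) \<le> s" and flow: "radial_flow N p f u v"
      and speed: "\<forall>r\<in>{s..s + (T1 + T2 + T3 + T1)}. 0 < u r \<and> u r < A1 \<longrightarrow> g (u r) \<le> \<bar>v r\<bar>"
    note du = radial_flow_DERIV(1)[OF flow]
    show "\<exists>z\<in>{s..s + (T1 + T2 + T3 + T1)}. u z \<le> 0"
    proof (rule ccontr)
      assume "\<not> ?thesis"
      then have pos: "u r > 0" if "s \<le> r" "r \<le> s + (T1 + T2 + T3 + T1)" for r
        using that by force
      have transit: "\<exists>r\<in>{a..a + T1}. A \<le> u r" if a: "s \<le> a" "a \<le> s + (T1 + T2 + T3)" for a
      proof (rule ccontr)
        assume "\<not> ?thesis"
        then have "u r < A" if "a \<le> r" "r \<le> a + T1" for r using that by force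
        then have "a + T1 - a \<le> 2 * K"
          using s a pos speed A T
          by (intro transit_time_bound[OF G K g, where u = u and v = v] du) force+
        then show False by (simp add: T1_def)
      qed
      obtain s1 where s1: "s \<le> s1" "s1 \<le> s + T1" "A \<le> u s1"
        using transit[of s] T by auto
      have "\<exists>t\<in>{s1..s1 + T2 + T3}. u t < A"
      proof (rule ccontr)
        assume "\<not> ?thesis"
        then have above: "A \<le> u r" if "s1 \<le> r" "r \<le> s1 + T2 + T3" for r using that by force
        obtain t where t: "s1 \<le> t" "t \<le> s1 + T2" "v t \<le> 0"
          using superlinear_turning[OF p c A(1) f flow, of s1] above s s1 T
          by (auto simp: T2_def add.assoc)
        obtain r where "t \<le> r" "r \<le> t + T3" "u r < A"
          using superlinear_descent[OF p c A(1) f flow, of t] t s s1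
          by (auto simp: T3_def add.assoc \<kappa>_def)
        then show False using above[of r] t by auto
      qed
      then obtain t where t: "s1 \<le> t" "t \<le> s1 + T2 + T3" "u t < A" by auto
      have cont: "continuous_on S u" if "S \<subseteq> {s..}" for S
        using s that by (intro radial_flow_continuous[OF flow]) auto
      \<comment> \<open>The mean value theorem after the last time \<open>m\<close> at which \<open>u \<ge> A\<close>.\<close>
      have "\<exists>z\<in>{s1..t}. u z < A \<and> v z < 0"
      proof -
        have "compact ({s1..t} \<inter> u -` {A..})"
          using s1 by (intro compact_Int_vimage cont) auto
        moreover have "s1 \<in> {s1..t} \<inter> u -` {A..}" using s1 t by auto
        ultimately obtain m where m: "m \<in> {s1..t} \<inter> u -` {A..}"
          and max: "\<forall>r\<in>{s1..t} \<inter> u -` {A..}. r \<le> m"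
          using compact_attains_sup[of "{s1..t} \<inter> u -` {A..}"] by blast
        have mt: "m < t" using m t(3) by (cases "m = t") auto
        obtain z where z: "m < z" "z < t" "u t - u m = (t - m) * v z"
          using MVT2[OF mt, of u v] du m s s1 by auto
        have "(t - m) * v z < 0" unfolding z(3)[symmetric] using m t(3) by auto
        then have "v z < 0" using mt by (simp add: mult_less_0_iff)
        moreover have "u z < A"
        proof (rule ccontr)
          assume "\<not> u z < A"
          then have "z \<in> {s1..t} \<inter> u -` {A..}" using z m by auto
          then show False using bspec[OF max, of z] z by auto
        qed
        ultimately show ?thesis using z m by force
      qed
      then obtain z where z: "s1 \<le> z" "z \<le> t" "u z < A" "v z < 0" by auto
      then have zs: "s \<le> z" "z \<le> s + (T1 + T2 + T3)" using s1 t by auto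
      \<comment> \<open>After \<open>z\<close> the solution gets back to \<open>A\<close>, so \<open>v\<close> vanishes at some \<open>w\<close> with \<open>0 < u w < A\<close>.\<close>
      from transit[OF this] obtain y where y: "z \<le> y" "y \<le> z + T1" "A \<le> u y" by auto
      have "compact ({z..y} \<inter> u -` {A..})"
        using zs by (intro compact_Int_vimage cont) auto
      moreover have "y \<in> {z..y} \<inter> u -` {A..}" using y by auto
      ultimately obtain m where m: "m \<in> {z..y} \<inter> u -` {A..}"
        and min: "\<forall>r\<in>{z..y} \<inter> u -` {A..}. m \<le> r"
        using compact_attains_inf[of "{z..y} \<inter> u -` {A..}"] by blast
      have zm: "z < m" using m z(3) by (cases "z = m") auto
      obtain x where x: "z < x" "x < m" "u m - u z = (m - z) * v x"
        using MVT2[OF zm, of u v] du zs s by auto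
      have "(m - z) * v x > 0" unfolding x(3)[symmetric] using m z(3) by auto
      then have "v x > 0" using zm by (simp add: zero_less_mult_iff)
      moreover have "continuous_on {z..x} v"
        using flow zs s unfolding radial_flow_def by (auto intro: continuous_on_subset)
      ultimately obtain w where w: "z \<le> w" "w \<le> x" "v w = 0"
        using IVT'[of v z 0 x] z(4) x by auto
      have "u w < A"
      proof (rule ccontr)
        assume "\<not> u w < A"
        then have "w \<in> {z..y} \<inter> u -` {A..}" using w x m by auto
        then show False using bspec[OF min, of w] w x by auto
      qed
      moreover have "s \<le> w" "w \<le> s + (T1 + T2 + T3 + T1)" using w x m y zs by auto
      ultimately have "0 < u w" "u w < A1" "g (u w) \<le> \<bar>v w\<bar>"
        using pos[of w] speed A by auto
      then show False using g[of "u w"] w by auto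
    qed
  qed (use T in auto)
qed

text \<open>The number \<open>A\<close> is chosen slightly above the largest positive zero of \<open>f\<close>. Up to that zero \<open>F\<close> is
negative, because an interior maximum of \<open>F\<close> would be a zero of \<open>f\<close>, where \<open>F < 0\<close>.\<close>

lemma half_line_structure:
  fixes f F :: "real \<Rightarrow> real"
  assumes cont: "continuous_on UNIV f" and F: "\<And>x. (F has_real_derivative f x) (at x)" and F0: "F 0 = 0"
    and neg: "\<exists>x>0. f x < 0"
    and zero: "\<forall>x>0. f x = 0 \<longrightarrow> F x < 0"
    and large: "\<exists>M. \<forall>x\<ge>M. x powr (p - 1) \<le> f x"
  shows "\<exists>A A1 c. 0 < A \<and> A < A1 \<and> 0 < c \<and> (\<forall>x\<ge>A. c * x powr (p - 1) \<le> f x) \<and> (\<forall>x. 0 < x \<and> x \<le> A1 \<longrightarrow> F x < 0)"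
proof -
  obtain a where a: "a > 0" "f a < 0" using neg by blast
  obtain M0 where M0: "\<And>x. M0 \<le> x \<Longrightarrow> x powr (p - 1) \<le> f x" using large by blast
  define M where "M = max M0 a + 1"
  have M: "M > a" "\<And>x. M \<le> x \<Longrightarrow> x powr (p - 1) \<le> f x" using M0 by (auto simp: M_def)
  have fM: "f x > 0" if "M \<le> x" for x
  proof -
    have "x \<noteq> 0" using M(1) a that by linarith
    then have "x powr (p - 1) > 0" by simp
    then show ?thesis using M(2)[OF that] by linarith
  qed
  have contS: "continuous_on S f" for S using cont continuous_on_subset by blast
  have contF: "continuous_on S F" for S
    by (intro continuous_at_imp_continuous_on ballI DERIV_isCont[OF F])
  obtain y where y: "a \<le> y" "y \<le> M" "f y = 0"
    using IVT'[of f a 0 M] a fM[of M] M contS by force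
  have "compact ({a..M} \<inter> f -` {0})" by (intro compact_Int_vimage contS) auto
  moreover have "y \<in> {a..M} \<inter> f -` {0}" using y by auto
  ultimately obtain z where z: "z \<in> {a..M} \<inter> f -` {0}" and zmax: "\<forall>x\<in>{a..M} \<inter> f -` {0}. x \<le> z"
    using compact_attains_sup[of "{a..M} \<inter> f -` {0}"] by blast
  have z0: "z > 0" "f z = 0" "F z < 0" using z a zero by auto
  have fpos: "f x > 0" if x: "x > z" for x
  proof (rule ccontr)
    assume nf: "\<not> f x > 0"
    then have xM: "x < M" using fM[of x] by force
    obtain w where "x \<le> w" "w \<le> M" "f w = 0"
      using IVT'[of f x 0 M] nf fM[of M] xM contS by force
    moreover from this have "w \<in> {a..M} \<inter> f -` {0}" using x z by auto
    ultimately show False using bspec[OF zmax, of w] x by auto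
  qed
  have Fneg: "F x < 0" if x: "0 < x" "x \<le> z" for x
  proof (rule ccontr)
    assume Fx: "\<not> F x < 0"
    obtain m where m: "m \<in> {0..z}" "\<forall>y\<in>{0..z}. F y \<le> F m"
      using continuous_attains_sup[of "{0..z}" F] contF z0 by auto
    \<comment> \<open>If the maximum is attained at the end point \<open>0\<close>, its value is \<open>0\<close> and \<open>x\<close> attains it too.\<close>
    define m' where "m' = (if m = 0 then x else m)"
    have Fm': "F m' \<ge> 0" "m' \<in> {0<..z}" "\<forall>y\<in>{0..z}. F y \<le> F m'"
      using m Fx x F0 by (auto simp: m'_def) (smt (verit, best) atLeastAtMost_iff)+
    then have "m' \<noteq> z" using z0 by auto
    then have m'z: "0 < m'" "m' < z" using Fm' by auto
    have "f m' = 0"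
    proof (rule DERIV_local_max[OF F])
      show "0 < min m' (z - m')" using m'z by simp
      show "\<forall>y. \<bar>m' - y\<bar> < min m' (z - m') \<longrightarrow> F y \<le> F m'" using Fm'(3) by (auto simp: abs_less_iff)
    qed
    then show False using zero m'z Fm' by force
  qed
  have "isCont F z" using F DERIV_isCont by blast
  then have "\<forall>\<^sub>F x in nhds z. F x < 0"
    using z0(3) order_tendstoD(2)[of F "F z" "nhds z" 0] by (simp add: continuous_within tendsto_at_iff_tendsto_nhds)
  then obtain d where d: "d > 0" "\<And>x. dist x z < d \<Longrightarrow> F x < 0" by (auto simp: eventually_nhds_metric)
  define A where "A = z + d / 3"
  define A1 where "A1 = z + d / 2"
  have A: "z < A" "A < A1" using d by (auto simp: A_def A1_def)
  have FA1: "F x < 0" if "0 < x" "x \<le> A1" for x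
  proof (cases "x \<le> z")
    case False
    then show ?thesis using that d(1) by (intro d(2)) (auto simp: dist_real_def A1_def)
  qed (use Fneg that in auto)
  obtain c0 where c0: "c0 > 0" "\<And>x. A \<le> x \<Longrightarrow> x \<le> max A M \<Longrightarrow> c0 * x powr (p - 1) \<le> f x"
  proof -
    have "continuous_on {A..max A M} (\<lambda>x. f x / x powr (p - 1))"
      using A z0 by (intro continuous_intros contS) auto
    then obtain m where m: "m \<in> {A..max A M}" "\<forall>x\<in>{A..max A M}. f m / m powr (p - 1) \<le> f x / x powr (p - 1)"
      using continuous_attains_inf[of "{A..max A M}" "\<lambda>x. f x / x powr (p - 1)"] by auto
    show ?thesis
    proof (rule that[of "f m / m powr (p - 1)"])
      show "0 < f m / m powr (p - 1)" using m A z0 fpos[of m] by auto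
      show "f m / m powr (p - 1) * x powr (p - 1) \<le> f x" if "A \<le> x" "x \<le> max A M" for x
      proof -
        have "x powr (p - 1) > 0" using that A z0 by simp
        moreover have "f m / m powr (p - 1) \<le> f x / x powr (p - 1)" using m(2) that by simp
        ultimately show ?thesis by (metis pos_le_divide_eq)
      qed
    qed
  qed
  have "min c0 1 * x powr (p - 1) \<le> f x" if "A \<le> x" for x
  proof (cases "x \<le> max A M")
    case True
    have "min c0 1 * x powr (p - 1) \<le> c0 * x powr (p - 1)" by (intro mult_right_mono) auto
    then show ?thesis using c0(2)[OF that True] by simp
  next
    case False
    have "min c0 1 * x powr (p - 1) \<le> 1 * x powr (p - 1)" by (intro mult_right_mono) auto
    then show ?thesis using M(2)[of x] False by (auto simp: not_le)
  qed
  moreover have "0 < min c0 1" using c0 by simp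
  ultimately show ?thesis using A z0 FA1
    by (intro exI[of _ A] exI[of _ A1] exI[of _ "min c0 1"]) auto
qed

text \<open>Integrability of \<open>\<bar>F\<bar>\<^bsup>-1/p\<^esup>\<close> near \<open>0\<close> provides the bounded antiderivative needed for
\<open>transit_time_bound\<close> with \<open>g = \<bar>F\<bar>\<^bsup>1/p\<^esup>\<close>.\<close>

lemma transit_function:
  fixes F :: "real \<Rightarrow> real"
  assumes contF: "continuous_on UNIV F" and F_neg: "\<forall>x. 0 < x \<and> x \<le> A1 \<longrightarrow> F x < 0"
    and p: "0 < p" and e: "e > 0"
    and int: "(\<integral>\<^sup>+x\<in>{0<..<e}. inverse (ennreal (\<bar>F x\<bar> powr (1 / p))) \<partial>lborel) < \<infinity>"
  shows "\<exists>G K. \<forall>x. 0 < x \<and> x < A1 \<longrightarrow>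
    (G has_real_derivative 1 / \<bar>F x\<bar> powr (1 / p)) (at x) \<and> \<bar>G x\<bar> \<le> K"
proof -
  have neg: "F x < 0" if "0 < x" "x \<le> A1" for x using F_neg that by blast
  define h where "h = (\<lambda>x. 1 / \<bar>F x\<bar> powr (1 / p))"
  have h0: "h x \<ge> 0" for x by (simp add: h_def)
  have [measurable]: "F \<in> borel_measurable borel" using contF by (rule borel_measurable_continuous_onI)
  have [measurable]: "h \<in> borel_measurable borel" unfolding h_def by measurable
  have conth: "continuous_on {0<..A1} h" unfolding h_def
    using neg p by (intro continuous_intros continuous_on_powr' continuous_on_subset[OF contF]) (auto, force)
  obtain B where B: "B \<ge> 0" "\<And>x. e / 2 \<le> x \<Longrightarrow> x \<le> A1 \<Longrightarrow> h x \<le> B"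
  proof (cases "e / 2 \<le> A1")
    case True
    have "continuous_on {e / 2..A1} h" using e by (intro continuous_on_subset[OF conth]) auto
    then obtain m where "m \<in> {e / 2..A1}" "\<forall>x\<in>{e / 2..A1}. h x \<le> h m"
      using continuous_attains_sup[of "{e / 2..A1}" h] True by auto
    then show ?thesis using that[of "h m"] h0 by auto
  qed (use that[of 0] in auto)
  have eq: "ennreal (h x) = inverse (ennreal (\<bar>F x\<bar> powr (1 / p)))" if "0 < x" "x \<le> A1" for x
  proof -
    have "\<bar>F x\<bar> powr (1 / p) > 0" using neg[OF that] by simp
    then show ?thesis by (simp add: h_def inverse_ennreal divide_inverse)
  qed
  have "(\<integral>\<^sup>+x. ennreal (indicator {0<..A1} x * h x) \<partial>lborel) \<le>
      (\<integral>\<^sup>+x. inverse (ennreal (\<bar>F x\<bar> powr (1 / p))) * indicator {0<..<e} x + ennreal B * indicator {0..A1} x \<partial>lborel)"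
  proof (rule nn_integral_mono)
    fix x :: real
    consider "0 < x" "x \<le> A1" "x < e" | "0 < x" "x \<le> A1" "e \<le> x" | "\<not> (0 < x \<and> x \<le> A1)" by linarith
    then show "ennreal (indicator {0<..A1} x * h x) \<le> inverse (ennreal (\<bar>F x\<bar> powr (1 / p))) * indicator {0<..<e} x
        + ennreal B * indicator {0..A1} x"
    proof cases
      case 2
      then show ?thesis using B(2)[of x] e by (simp add: ennreal_leI)
    qed (auto simp: eq)
  qed
  also have "\<dots> = (\<integral>\<^sup>+x\<in>{0<..<e}. inverse (ennreal (\<bar>F x\<bar> powr (1 / p))) \<partial>lborel) + ennreal B * emeasure lborel {0..A1}"
    by (subst nn_integral_add) (auto simp: nn_integral_cmult_indicator)
  also have "\<dots> < \<infinity>" using int by (auto simp: ennreal_mult_less_top emeasure_lborel_Icc_eq)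
  finally have "integrable lborel (\<lambda>x. indicator {0<..A1} x * h x)"
    using h0 by (intro integrableI_bounded) (auto simp: abs_mult)
  then have int_UNIV: "(\<lambda>x. indicator {0<..A1} x * h x) integrable_on UNIV"
    by (rule integrable_on_lborel)
  define k where "k = (\<lambda>x. indicator {0<..A1} x * h x :: real)"
  have kint: "k integrable_on {0..A1}"
    using integrable_on_subinterval[OF int_UNIV, of 0 A1] by (simp add: k_def)
  define G where "G = (\<lambda>x. integral {0..x} k)"
  have "(G has_real_derivative h x) (at x) \<and> \<bar>G x\<bar> \<le> integral {0..A1} k" if x: "0 < x" "x < A1" for x
  proof
    have "continuous (at x within {0..A1}) k"
    proof -
      have "continuous_on {0<..<A1} h" using conth by (rule continuous_on_subset) auto
      then have "isCont h x" using x by (simp add: continuous_on_eq_continuous_at)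
      moreover have "\<forall>\<^sub>F y in nhds x. k y = h y"
        by (rule eventually_mono[OF eventually_nhds_in_open[of "{0<..<A1}"]]) (use x in \<open>auto simp: k_def\<close>)
      ultimately have "isCont k x" using isCont_cong by blast
      then show ?thesis by (rule continuous_at_imp_continuous_at_within)
    qed
    then have "(G has_vector_derivative k x) (at x within {0..A1})"
      unfolding G_def using integral_has_vector_derivative_continuous_at[OF kint, of x "{}"] x by auto
    moreover have "at x within {0..A1} = at x" using x by (intro at_within_interior) auto
    ultimately show "(G has_real_derivative h x) (at x)"
      using x by (simp add: has_real_derivative_iff_has_vector_derivative k_def)
    have sub: "k integrable_on {0..x}" using kint x integrable_on_subinterval by fastforce
    have k0: "k y \<ge> 0" for y by (simp add: k_def h0)
    have "G x \<le> integral {0..A1} k" unfolding G_def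
      using x by (intro integral_subset_le sub kint) (auto simp: k0)
    moreover have "G x \<ge> 0" unfolding G_def using sub by (intro integral_nonneg) (auto simp: k0)
    ultimately show "\<bar>G x\<bar> \<le> integral {0..A1} k" by simp
  qed
  then show ?thesis unfolding h_def by blast
qed

lemma half_line_oscillation:
  fixes f F :: "real \<Rightarrow> real"
  assumes p: "1 < p" and cont: "continuous_on UNIV f"
    and F: "\<And>x. (F has_real_derivative f x) (at x)" and F0: "F 0 = 0"
    and neg: "\<exists>x>0. f x < 0"
    and zero: "\<forall>x>0. f x = 0 \<longrightarrow> F x < 0"
    and large: "\<exists>M. \<forall>x\<ge>M. x powr (p - 1) \<le> f x"
    and e: "e > 0"
    and int: "(\<integral>\<^sup>+x\<in>{0<..<e}. inverse (ennreal (\<bar>F x\<bar> powr (1 / p))) \<partial>lborel) < \<infinity>"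
  shows "\<exists>T>0. \<exists>s0\<ge>1. \<forall>u v. \<forall>s\<ge>s0. radial_flow N p f u v \<longrightarrow>
    (\<forall>r\<in>{s..s + T}. 0 < \<bar>v r\<bar> powr p / (p / (p - 1)) + F (u r)) \<longrightarrow> (\<exists>z\<in>{s..s + T}. u z \<le> 0)"
proof -
  from half_line_structure[OF cont F F0 neg zero large]
  obtain A A1 c where A: "0 < A" "A < A1" "0 < c" "\<forall>x\<ge>A. c * x powr (p - 1) \<le> f x"
    "\<forall>x. 0 < x \<and> x \<le> A1 \<longrightarrow> F x < 0"
    by (elim exE conjE)
  have contF: "continuous_on UNIV F"
    by (intro continuous_at_imp_continuous_on ballI DERIV_isCont[OF F])
  have "0 < p" using p by simp
  from transit_function[OF contF A(5) this e int] obtain G K where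
    GK: "\<forall>x. 0 < x \<and> x < A1 \<longrightarrow> (G has_real_derivative 1 / \<bar>F x\<bar> powr (1 / p)) (at x) \<and> \<bar>G x\<bar> \<le> K"
    by (elim exE)
  have g: "\<forall>x. 0 < x \<and> x < A1 \<longrightarrow> 0 < \<bar>F x\<bar> powr (1 / p)"
    using A(5) by (auto simp: less_imp_le order.strict_implies_not_eq)
  have speed: "\<bar>F x\<bar> powr (1 / p) \<le> \<bar>w\<bar>"
    if "0 < x" "x < A1" "0 < \<bar>w\<bar> powr p / (p / (p - 1)) + F x" for x w
  proof -
    have "\<bar>F x\<bar> \<le> \<bar>w\<bar> powr p / (p / (p - 1))" using that A(5) by (auto simp: abs_of_neg)
    also have "\<dots> \<le> \<bar>w\<bar> powr p / 1" using p by (intro divide_left_mono) (auto simp: field_simps)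
    finally have "\<bar>F x\<bar> powr (1 / p) \<le> (\<bar>w\<bar> powr p) powr (1 / p)"
      using p by (intro powr_mono2) auto
    then show ?thesis using p by (simp add: powr_powr)
  qed
  from zero_from_transit_and_descent[OF p A(3,1,2,4) GK g, of N]
  obtain T s0 where T: "T > 0" "s0 \<ge> 1" and hit: "\<forall>u v. \<forall>s\<ge>s0. radial_flow N p f u v \<longrightarrow>
    (\<forall>r\<in>{s..s + T}. 0 < u r \<and> u r < A1 \<longrightarrow> \<bar>F (u r)\<bar> powr (1 / p) \<le> \<bar>v r\<bar>) \<longrightarrow> (\<exists>z\<in>{s..s + T}. u z \<le> 0)"
    by (elim exE conjE)
  have "\<exists>z\<in>{s..s + T}. u z \<le> 0" if "s \<ge> s0" "radial_flow N p f u v"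
    "\<forall>r\<in>{s..s + T}. 0 < \<bar>v r\<bar> powr p / (p / (p - 1)) + F (u r)" for u v s
  proof -
    have "\<forall>r\<in>{s..s + T}. 0 < u r \<and> u r < A1 \<longrightarrow> \<bar>F (u r)\<bar> powr (1 / p) \<le> \<bar>v r\<bar>"
      using that(3) speed by blast
    then show ?thesis using hit that(1,2) by blast
  qed
  then show ?thesis using T by blast
qed

lemma oscillation:
  fixes f F :: "real \<Rightarrow> real"
  assumes p: "1 < p" and cont: "continuous_on UNIV f"
    and F: "\<And>x. (F has_real_derivative f x) (at x)" and F0: "F 0 = 0"
    and neg: "\<exists>x>0. f x < 0" "\<exists>x<0. f x > 0"
    and zero: "\<forall>x. x \<noteq> 0 \<and> f x = 0 \<longrightarrow> F x < 0"
    and large: "\<exists>M. \<forall>x\<ge>M. x powr (p - 1) \<le> f x" "\<exists>M. \<forall>x\<ge>M. x powr (p - 1) \<le> - f (- x)"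
    and e: "e > 0"
    and int: "(\<integral>\<^sup>+x\<in>{- e<..<e}. inverse (ennreal (\<bar>F x\<bar> powr (1 / p))) \<partial>lborel) < \<infinity>"
  shows "\<exists>T>0. \<exists>s0\<ge>1. \<forall>u v. \<forall>s\<ge>s0. radial_flow N p f u v \<longrightarrow>
    (\<forall>r\<in>{s..s + T}. 0 < \<bar>v r\<bar> powr p / (p / (p - 1)) + F (u r)) \<longrightarrow> (\<exists>z\<in>{s..s + T}. u z = 0)"
proof -
  let ?I = "\<lambda>x. inverse (ennreal (\<bar>F x\<bar> powr (1 / p)))"
  have contF: "continuous_on UNIV F"
    by (intro continuous_at_imp_continuous_on ballI DERIV_isCont[OF F])
  have [measurable]: "F \<in> borel_measurable borel" using contF by (rule borel_measurable_continuous_onI)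
  have "(\<integral>\<^sup>+x\<in>{0<..<e}. ?I x \<partial>lborel) \<le> (\<integral>\<^sup>+x\<in>{- e<..<e}. ?I x \<partial>lborel)"
    using e by (intro nn_integral_mono) (auto simp: indicator_def)
  with int have int1: "(\<integral>\<^sup>+x\<in>{0<..<e}. ?I x \<partial>lborel) < \<infinity>" by (rule le_less_trans[rotated])
  \<comment> \<open>The negative half-line is the positive one for the reflected nonlinearity \<open>- f (- x)\<close>.\<close>
  have "(\<integral>\<^sup>+x\<in>{0<..<e}. ?I (- x) \<partial>lborel) = (\<integral>\<^sup>+x\<in>{- e<..<0}. ?I x \<partial>lborel)"
    by (subst nn_integral_real_affine[where c = "-1" and t = 0])
      (auto intro!: nn_integral_cong simp: indicator_def)
  also have "\<dots> \<le> (\<integral>\<^sup>+x\<in>{- e<..<e}. ?I x \<partial>lborel)"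
    using e by (intro nn_integral_mono) (auto simp: indicator_def)
  finally have int2: "(\<integral>\<^sup>+x\<in>{0<..<e}. ?I (- x) \<partial>lborel) < \<infinity>"
    using int by (rule le_less_trans)
  have zero1: "\<forall>x>0. f x = 0 \<longrightarrow> F x < 0" and zero': "\<forall>x>0. - f (- x) = 0 \<longrightarrow> F (- x) < 0"
    using zero by auto
  from half_line_oscillation[OF p cont F F0 neg(1) zero1 large(1) e int1, of N]
  obtain T s0 where T: "T > 0" "s0 \<ge> 1" and hit: "\<forall>u v. \<forall>s\<ge>s0. radial_flow N p f u v \<longrightarrow>
    (\<forall>r\<in>{s..s + T}. 0 < \<bar>v r\<bar> powr p / (p / (p - 1)) + F (u r)) \<longrightarrow> (\<exists>z\<in>{s..s + T}. u z \<le> 0)"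
    by (elim exE conjE)
  have cont': "continuous_on UNIV (\<lambda>x. - f (- x))"
    by (intro continuous_intros continuous_on_compose2[OF cont]) auto
  have F': "((\<lambda>x. F (- x)) has_real_derivative - f (- x)) (at x)" for x
    using DERIV_chain2[OF F[of "- x"] DERIV_minus[OF DERIV_ident]] by simp
  have neg': "\<exists>x>0. - f (- x) < 0"
    using neg(2) by (metis minus_minus neg_0_less_iff_less neg_less_0_iff_less)
  have "(\<lambda>x. F (- x)) 0 = 0" using F0 by simp
  from half_line_oscillation[OF p cont' F' this neg' zero' large(2) e int2, of N]
  obtain T' s0' where T': "T' > 0" "s0' \<ge> 1"
    and hit': "\<forall>u v. \<forall>s\<ge>s0'. radial_flow N p (\<lambda>x. - f (- x)) u v \<longrightarrow>
    (\<forall>r\<in>{s..s + T'}. 0 < \<bar>v r\<bar> powr p / (p / (p - 1)) + F (- u r)) \<longrightarrow> (\<exists>z\<in>{s..s + T'}. u z \<le> 0)"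
    by (elim exE conjE)
  have "\<exists>z\<in>{s..s + max T T'}. u z = 0" if s: "max s0 s0' \<le> s" and flow: "radial_flow N p f u v"
    and E: "\<forall>r\<in>{s..s + max T T'}. 0 < \<bar>v r\<bar> powr p / (p / (p - 1)) + F (u r)" for u v s
  proof -
    have E1: "\<forall>r\<in>{s..s + T}. 0 < \<bar>v r\<bar> powr p / (p / (p - 1)) + F (u r)"
      and E2: "\<forall>r\<in>{s..s + T'}. 0 < \<bar>- v r\<bar> powr p / (p / (p - 1)) + F (- (- u r))"
      using E by auto
    obtain z where z: "z \<in> {s..s + T}" "u z \<le> 0" proof -
      have "s0 \<le> s" using s by simp
      then have "\<exists>z\<in>{s..s + T}. u z \<le> 0" using hit flow E1 by blast
      then show ?thesis using that by blast
    qed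
    obtain y where y: "y \<in> {s..s + T'}" "- u y \<le> 0"
    proof -
      have "s0' \<le> s" using s by simp
      from hit'[rule_format, OF this radial_flow_minus[OF flow] bspec[OF E2]]
      have "\<exists>y\<in>{s..s + T'}. - u y \<le> 0" by blast
      then show ?thesis using that by blast
    qed
    have "connected (u ` {s..s + max T T'})"
      using s T by (intro connected_continuous_image radial_flow_continuous[OF flow]) auto
    moreover have "u z \<in> u ` {s..s + max T T'}" "u y \<in> u ` {s..s + max T T'}" using z y by auto
    ultimately have "0 \<in> u ` {s..s + max T T'}"
      using connectedD_interval[of "u ` {s..s + max T T'}" "u z" "u y" 0] z y by auto
    then show ?thesis by force
  qed
  then show ?thesis using T T' by (intro exI[of _ "max T T'"] exI[of _ "max s0 s0'"] conjI) auto
qed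

section \<open>The solution near the origin and the Pohozaev estimate\<close>

lemma start_plateau:
  fixes N :: nat and p l th :: real and f u v :: "real \<Rightarrow> real"
  defines "R \<equiv> (((1 - th) * l) powr (p - 1) / f l) powr (1 / p)"
  assumes p: "1 < p" and N: "2 \<le> N" and flow: "radial_flow N p f u v"
    and cu: "continuous_on {0..} u" and cv: "continuous_on {0..} v"
    and init: "u 0 = l" "v 0 = 0" and l: "0 < l" and th: "0 < th" "th < 1"
    and mono: "mono_on {th * l..} f" and f: "0 \<le> f (th * l)" "0 < f l"
    and r: "0 \<le> r" "r \<le> R"
  shows "th * l \<le> u r" "u r \<le> l"
proof -
  note du = radial_flow_DERIV(1)[OF flow] and dD = radial_flow_DERIV(2)[OF flow]
  let ?D = "\<lambda>r. r ^ (N - 1) * phi p (v r)"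
  have contD: "continuous_on {0..b} ?D" for b
    by (intro continuous_intros continuous_on_compose2[OF continuous_on_phi[OF p, of UNIV]]
        continuous_on_subset[OF cv]) auto
  have D0: "?D 0 = 0" using init by (simp add: phi_def)
  have thl: "th * l < l" using th l by simp
  have R: "R > 0" unfolding R_def using th l f by simp
  \<comment> \<open>\<open>R\<close> is the time in which slope \<open>(f l * R) powr (1 / (p - 1))\<close> loses \<open>(1 - th) * l\<close>.\<close>
  have Rid: "R * (f l * R) powr (1 / (p - 1)) = (1 - th) * l"
  proof -
    have "R powr p = ((1 - th) * l) powr (p - 1) / f l"
      unfolding R_def using p f l th by (simp add: powr_powr)
    then have "f l * R * R powr (p - 1) = ((1 - th) * l) powr (p - 1)"
    proof -
      have "f l * R * R powr (p - 1) = f l * R powr p"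
        using R powr_mult_base[of R "p - 1"] by (simp add: mult.assoc)
      then show ?thesis using f \<open>R powr p = _\<close> by simp
    qed
    then have "(f l * R * R powr (p - 1)) powr (1 / (p - 1)) = (1 - th) * l"
      using p l th by (simp add: powr_powr)
    then show ?thesis using R f p by (simp add: powr_mult powr_powr mult.commute)
  qed
  \<comment> \<open>While \<open>u \<ge> th * l\<close>, the true slope is smaller (a factor \<open>1 / N \<le> 1 / 2\<close> is gained), so the
    inequality is strict and persists.\<close>
  have claim: "u x \<le> l \<and> (0 < x \<longrightarrow> th * l < u x)" if b: "0 \<le> b" "b \<le> R"
    and above: "\<And>r. 0 \<le> r \<Longrightarrow> r \<le> b \<Longrightarrow> th * l \<le> u r" and x: "0 \<le> x" "x \<le> b" for b x
  proof -
    have fu: "0 \<le> f (u r)" if "0 \<le> r" "r \<le> b" for r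
      using monotone_onD[OF mono, of "th * l" "u r"] above[OF that] f by auto
    have "?D r \<le> ?D 0" if "0 \<le> r" "r \<le> b" for r
    proof (rule DERIV_nonpos_imp_decreasing_open[OF that(1)])
      fix y assume "0 < y" "y < r"
      then show "\<exists>d. (?D has_real_derivative d) (at y) \<and> d \<le> 0"
        using dD[of y] fu[of y] that by (intro exI[of _ "- (y ^ (N - 1) * f (u y))"]) simp
    qed (rule contD)
    then have v0: "v r \<le> 0" if "0 < r" "r \<le> b" for r
      using that D0 phi_zero_less_iff[of p "v r"]
      by (smt (verit, best) mult_pos_pos zero_less_power)
    have ul: "u r \<le> l" if "0 \<le> r" "r \<le> b" for r
      unfolding init(1)[symmetric]
    proof (rule DERIV_nonpos_imp_decreasing_open[OF that(1)])
      show "continuous_on {0..r} u" using cu by (rule continuous_on_subset) auto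
      fix y assume "0 < y" "y < r"
      then show "\<exists>d. (u has_real_derivative d) (at y) \<and> d \<le> 0"
        using du[of y] v0[of y] that by auto
    qed
    have slow: "- v r \<le> (f l * R / 2) powr (1 / (p - 1))" if rr: "0 < r" "r \<le> b" for r
    proof -
      have "?D 0 + f l * 0 ^ N / real N \<le> ?D r + f l * r ^ N / real N"
      proof (rule DERIV_nonneg_imp_increasing_open[of 0 r "\<lambda>r. ?D r + f l * r ^ N / real N"])
        fix y assume y: "0 < y" "y < r"
        have "((\<lambda>r. ?D r + f l * r ^ N / real N) has_real_derivative
            - (y ^ (N - 1) * f (u y)) + f l * (real N * y ^ (N - 1)) / real N) (at y)"
          using y by (intro DERIV_add dD DERIV_cdivide DERIV_cmult) (auto intro!: derivative_eq_intros)
        moreover have "f (u y) \<le> f l"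
          using monotone_onD[OF mono, of "u y" l] above[of y] ul[of y] thl y rr by auto
        then have "y ^ (N - 1) * f (u y) \<le> y ^ (N - 1) * f l" using y by (intro mult_left_mono) auto
        then have "0 \<le> - (y ^ (N - 1) * f (u y)) + f l * (real N * y ^ (N - 1)) / real N"
          using N by (simp add: mult.commute)
        ultimately show "\<exists>d. ((\<lambda>r. ?D r + f l * r ^ N / real N) has_real_derivative d) (at y) \<and> 0 \<le> d"
          by blast
      next
        show "continuous_on {0..r} (\<lambda>r. ?D r + f l * r ^ N / real N)"
          using N by (intro continuous_on_add contD continuous_intros) auto
      qed (use rr in simp)
      then have "- ?D r \<le> f l * r ^ N / real N" using D0 N by (simp add: zero_power)
      also have "\<dots> \<le> f l * r ^ N / 2" using N f rr by (intro divide_left_mono) auto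
      also have "\<dots> = r ^ (N - 1) * (f l * r / 2)"
        using N by (cases N) auto
      finally have "r ^ (N - 1) * (- phi p (v r)) \<le> r ^ (N - 1) * (f l * r / 2)" by simp
      then have "- phi p (v r) \<le> f l * r / 2" by (rule mult_left_le_imp_le) (use rr in simp)
      also have "\<dots> \<le> f l * R / 2" using rr b f by (intro divide_right_mono mult_left_mono) auto
      finally have "(- v r) powr (p - 1) \<le> f l * R / 2"
        using v0[OF rr] phi_nonneg_eq[of "- v r" p] by (simp add: phi_minus)
      then have "((- v r) powr (p - 1)) powr (1 / (p - 1)) \<le> (f l * R / 2) powr (1 / (p - 1))"
        using p by (intro powr_mono2) auto
      then show ?thesis using p v0[OF rr] by (simp add: powr_powr)
    qed
    have "th * l < u x" if "0 < x"
    proof -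
      have "\<exists>z>0. z < x \<and> u x - u 0 = (x - 0) * v z"
      proof -
        have "continuous_on {0..x} u" using cu by (rule continuous_on_subset) auto
        then obtain d z where "0 < z" "z < x" "(u has_real_derivative d) (at z)" "u x - u 0 = (x - 0) * d"
          using MVT[of 0 x u] du \<open>0 < x\<close> by (auto simp: real_differentiable_def)
        then show ?thesis using DERIV_unique[OF du[of z]] by blast
      qed
      then obtain z where z: "0 < z" "z < x" "u x - u 0 = (x - 0) * v z" by blast
      have "l - u x = x * - v z" using z init by simp
      also have "\<dots> \<le> R * (f l * R / 2) powr (1 / (p - 1))"
        using z x b slow[of z] v0[of z] by (intro mult_mono) auto
      also have "\<dots> < R * (f l * R) powr (1 / (p - 1))"
        using R f p by (intro mult_strict_left_mono powr_less_mono2) auto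
      also have "\<dots> = l - th * l" using Rid by (simp add: algebra_simps)
      finally show ?thesis by simp
    qed
    then show ?thesis using ul x by auto
  qed
  have above: "th * l < u x" if "0 \<le> x" "x \<le> R" for x
  proof (rule ccontr)
    assume "\<not> th * l < u x"
    then have "x \<in> {0..R} \<inter> u -` {..th * l}" using that by auto
    moreover have "compact ({0..R} \<inter> u -` {..th * l})"
      by (intro compact_Int_vimage continuous_on_subset[OF cu]) auto
    ultimately obtain m where m: "m \<in> {0..R} \<inter> u -` {..th * l}"
      and min: "\<forall>x\<in>{0..R} \<inter> u -` {..th * l}. m \<le> x"
      using compact_attains_inf[of "{0..R} \<inter> u -` {..th * l}"] by blast
    have m0: "m > 0" using m init thl by (cases "m = 0") auto
    have below: "th * l < u y" if "0 \<le> y" "y < m" for y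
    proof (rule ccontr)
      assume "\<not> th * l < u y"
      then have "y \<in> {0..R} \<inter> u -` {..th * l}" using that m by auto
      then show False using bspec[OF min, of y] that by auto
    qed
    obtain y where y: "0 \<le> y" "y \<le> m" "u y = th * l"
      using IVT2'[of u m "th * l" 0] m m0 init thl continuous_on_subset[OF cu, of "{0..m}"] by auto
    have "y = m" using below[of y] y by (cases "y = m") auto
    then have "th * l \<le> u z" if "0 \<le> z" "z \<le> m" for z
      using below[of z] that y by (cases "z = m") auto
    then have "th * l < u m" using claim[of m m] m m0 by auto
    then show False using m by auto
  qed
  show "th * l \<le> u r" using above[of r] r by simp
  show "u r \<le> l" using claim[of R r] above r by (auto simp: less_imp_le)
qed

text \<open>If the integrand \<open>H(u)\<close> of the Pohozaev identity is at least \<open>d\<close> on \<open>[0, R]\<close> and at least \<open>- C0\<close>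
everywhere, then integration bounds the Pohozaev function from below at every \<open>r \<ge> R\<close>.\<close>

lemma Pohozaev_lower_bound:
  fixes N :: nat and p C0 d :: real and f F :: "real \<Rightarrow> real"
  defines "H \<equiv> \<lambda>x. real N * F x - (real N - p) / p * (x * f x)"
  assumes p: "1 < p" and N: "0 < N" and flow: "radial_flow N p f u v"
    and F: "\<And>x. (F has_real_derivative f x) (at x)"
    and cu: "continuous_on {0..} u" and cv: "continuous_on {0..} v" and v0: "v 0 = 0"
    and below: "\<And>x. - C0 \<le> H x" and C0: "0 \<le> C0"
    and near: "\<And>r. 0 \<le> r \<Longrightarrow> r \<le> R \<Longrightarrow> d \<le> H (u r)" and R: "0 \<le> R" "R \<le> r"
  shows "d * R ^ N / real N - C0 * r ^ N / real N \<le>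
    r ^ N * (\<bar>v r\<bar> powr p / (p / (p - 1)) + F (u r)) + (real N - p) / p * (r ^ (N - 1) * phi p (v r)) * u r"
proof -
  define P where "P = (\<lambda>r. r ^ N * (\<bar>v r\<bar> powr p / (p / (p - 1)) + F (u r))
      + (real N - p) / p * (r ^ (N - 1) * phi p (v r)) * u r)"
  have dP: "(P has_real_derivative r ^ (N - 1) * H (u r)) (at r)" if "r > 0" for r
    unfolding P_def H_def by (rule DERIV_Pohozaev[OF p N flow F that])
  have contF: "continuous_on UNIV F"
    by (intro continuous_at_imp_continuous_on ballI DERIV_isCont[OF F])
  have contP: "continuous_on {a..b} P" if "0 \<le> a" for a b
    unfolding P_def using p that
    by (intro continuous_intros continuous_on_powr' continuous_on_compose2[OF continuous_on_phi[OF p, of UNIV]]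
        continuous_on_compose2[OF contF] continuous_on_subset[OF cv] continuous_on_subset[OF cu]) auto
  have dQ: "((\<lambda>r. P r + c * r ^ N / real N) has_real_derivative y ^ (N - 1) * (H (u y) + c)) (at y)"
    if "y > 0" for y c
  proof -
    have "((\<lambda>r. P r + c * r ^ N / real N) has_real_derivative
        y ^ (N - 1) * H (u y) + c * (real N * y ^ (N - 1)) / real N) (at y)"
      using that by (intro DERIV_add dP DERIV_cdivide DERIV_cmult) (auto intro!: derivative_eq_intros)
    then show ?thesis using N by (simp add: algebra_simps)
  qed
  have "P 0 + (- d) * 0 ^ N / real N \<le> P R + (- d) * R ^ N / real N"
  proof (rule DERIV_nonneg_imp_increasing_open[OF R(1), of "\<lambda>r. P r + (- d) * r ^ N / real N"])
    fix y assume y: "0 < y" "y < R"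
    have "0 \<le> y ^ (N - 1) * (H (u y) + (- d))" using y near[of y] by simp
    then show "\<exists>e. ((\<lambda>r. P r + (- d) * r ^ N / real N) has_real_derivative e) (at y) \<and> 0 \<le> e"
      using dQ[OF y(1)] by blast
  qed (use N in \<open>auto intro!: continuous_intros contP\<close>)
  moreover have "P 0 = 0" using N v0 by (simp add: P_def phi_def zero_power)
  ultimately have PR: "d * R ^ N / real N \<le> P R" using N by (simp add: zero_power)
  have "P R + C0 * R ^ N / real N \<le> P r + C0 * r ^ N / real N"
  proof (rule DERIV_nonneg_imp_increasing_open[OF R(2), of "\<lambda>r. P r + C0 * r ^ N / real N"])
    fix y assume y: "R < y" "y < r"
    have "0 \<le> y ^ (N - 1) * (H (u y) + C0)" using y R below[of "u y"] by simp
    then show "\<exists>e. ((\<lambda>r. P r + C0 * r ^ N / real N) has_real_derivative e) (at y) \<and> 0 \<le> e"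
      using dQ[of y] y R by auto
  qed (use N R in \<open>auto intro!: continuous_intros contP\<close>)
  moreover have "0 \<le> C0 * R ^ N / real N" using C0 R by simp
  ultimately show ?thesis using PR unfolding P_def by linarith
qed

section \<open>Consequences of subcritical growth\<close>

lemma filterlim_powr_at_top:
  fixes s :: real
  assumes "0 < s"
  shows "filterlim (\<lambda>x. x powr s) at_top at_top"
proof -
  have "filterlim (\<lambda>x. exp (s * ln x)) at_top at_top"
    using assms by (intro filterlim_compose[OF exp_at_top]
        filterlim_tendsto_pos_mult_at_top[OF tendsto_const] ln_at_top)
  moreover have "\<forall>\<^sub>F x in at_top. exp (s * ln x) = x powr s"
    using eventually_gt_at_top[of 0] by eventually_elim (simp add: powr_def)
  ultimately show ?thesis by (simp add: filterlim_cong[OF refl refl])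
qed

text \<open>The growth conditions on \<open>f\<close> with explicit thresholds: \<open>F\<close> is the primitive of \<open>f\<close> with \<open>F 0 = 0\<close>,
\<open>f\<close> is nondecreasing on \<open>[M, \<infinity>)\<close>, and for \<open>\<bar>x\<bar> \<ge> M\<close> one has \<open>x f x \<ge> \<bar>x\<bar>\<^sup>p\<close> and
\<open>F (\<theta> x) \<ge> \<kappa> x f x\<close> with \<open>\<kappa>\<close> strictly above the critical value \<open>(N - p) / (N p)\<close>.\<close>

locale subcritical_nonlinearity =
  fixes N :: nat and p :: real and f F :: "real \<Rightarrow> real" and \<theta> \<kappa> M :: real
  assumes p: "1 < p" "p < real N"
    and cont: "continuous_on UNIV f" and F: "\<And>x. (F has_real_derivative f x) (at x)" and F0: "F 0 = 0"
    and th: "0 < \<theta>" "\<theta> < 1" and kappa: "(real N - p) / (real N * p) < \<kappa>"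
    and M: "1 \<le> M" and mono: "mono_on {M..} f"
    and f_pos: "\<And>x. M \<le> x \<Longrightarrow> x powr (p - 1) \<le> f x"
    and f_neg: "\<And>x. M \<le> x \<Longrightarrow> x powr (p - 1) \<le> - f (- x)"
    and F_ge: "\<And>x. M \<le> \<bar>x\<bar> \<Longrightarrow> \<kappa> * (x * f x) \<le> F (\<theta> * x)"
begin

lemma kappa_pos: "0 < \<kappa>"
proof -
  have "0 < (real N - p) / (real N * p)" using p by auto
  then show ?thesis using kappa by simp
qed

lemma contF: "continuous_on S F"
  by (intro continuous_at_imp_continuous_on ballI DERIV_isCont[OF F])

lemma xf_pos:
  assumes "M \<le> \<bar>x\<bar>"
  shows "0 < x * f x"
proof (cases "0 \<le> x")
  case True
  then have "0 < x" using assms M by linarith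
  then have "0 < x powr (p - 1)" by simp
  also have "\<dots> \<le> f x" using True assms by (intro f_pos) simp
  finally show ?thesis using \<open>0 < x\<close> by simp
next
  case False
  then have "0 < (- x) powr (p - 1)" by simp
  also have "\<dots> \<le> - f (- (- x))" using False assms by (intro f_neg) simp
  finally have "0 < - f x" by simp
  then show ?thesis using False by (auto intro!: mult_neg_neg)
qed

lemma F_pos:
  assumes "M \<le> \<bar>x\<bar>"
  shows "0 < F x"
proof -
  have "\<bar>x\<bar> * 1 \<le> \<bar>x\<bar> * (1 / \<theta>)" using th by (intro mult_left_mono) auto
  then have x: "M \<le> \<bar>x / \<theta>\<bar>" using assms th by (simp add: abs_divide)
  have "0 < \<kappa> * (x / \<theta> * f (x / \<theta>))" using xf_pos[OF x] kappa_pos by (rule mult_pos_pos[rotated])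
  also have "\<dots> \<le> F x" using F_ge[OF x] th by simp
  finally show ?thesis .
qed

lemma F_mono_pos:
  assumes "M \<le> x" "x \<le> y"
  shows "F x \<le> F y"
proof (rule DERIV_nonneg_imp_nondecreasing[OF assms(2)])
  fix z assume z: "x \<le> z" "z \<le> y"
  have "0 < z * f z" using assms(1) z by (intro xf_pos) auto
  then have "0 \<le> f z" using assms(1) z M by (auto simp: zero_less_mult_iff)
  then show "\<exists>d. (F has_real_derivative d) (at z) \<and> 0 \<le> d" using F by blast
qed

lemma F_mono_neg:
  assumes "x \<le> y" "y \<le> - M"
  shows "F y \<le> F x"
proof (rule DERIV_nonpos_imp_nonincreasing[OF assms(1)])
  fix z assume z: "x \<le> z" "z \<le> y"
  have "0 < z * f z" using assms(2) z M by (intro xf_pos) auto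
  then have "f z \<le> 0" using assms(2) z M by (auto simp: zero_less_mult_iff)
  then show "\<exists>d. (F has_real_derivative d) (at z) \<and> d \<le> 0" using F by blast
qed

lemma F_scale:
  assumes "M / \<theta> \<le> \<bar>x\<bar>"
  shows "F (\<theta> * x) \<le> F x"
proof -
  have m: "M \<le> \<theta> * \<bar>x\<bar>" using assms th by (simp add: divide_le_eq mult.commute)
  have le: "\<theta> * \<bar>x\<bar> \<le> 1 * \<bar>x\<bar>" using th by (intro mult_right_mono) auto
  show ?thesis
  proof (cases "0 \<le> x")
    case True
    then show ?thesis using m le by (intro F_mono_pos) auto
  next
    case False
    then show ?thesis using m le by (intro F_mono_neg) auto
  qed
qed

lemma M_le_div: "M \<le> M / \<theta>"
  using M th by (simp add: le_divide_eq mult_left_le)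

lemma Pohozaev_gap: "0 < real N * \<kappa> - (real N - p) / p"
proof -
  have "real N * ((real N - p) / (real N * p)) < real N * \<kappa>"
    using kappa p by (intro mult_strict_left_mono) auto
  then show ?thesis using p by simp
qed

lemma Pohozaev_bounded_below:
  "\<exists>C\<ge>0. \<forall>x. - C \<le> real N * F x - (real N - p) / p * (x * f x)"
proof -
  let ?H = "\<lambda>x. real N * F x - (real N - p) / p * (x * f x)"
  have "continuous_on {- (M / \<theta>)..M / \<theta>} ?H"
    by (intro continuous_intros contF continuous_on_subset[OF cont]) auto
  then obtain m where m: "\<forall>x\<in>{- (M / \<theta>)..M / \<theta>}. ?H m \<le> ?H x"
    using continuous_attains_inf[of "{- (M / \<theta>)..M / \<theta>}" ?H] M th by auto
  have "- \<bar>?H m\<bar> \<le> ?H x" for x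
  proof (cases "M / \<theta> \<le> \<bar>x\<bar>")
    case True
    then have x: "M \<le> \<bar>x\<bar>" using M_le_div by simp
    have "real N * (\<kappa> * (x * f x)) \<le> real N * F x"
      using F_ge[OF x] F_scale[OF True] by (intro mult_left_mono) auto
    moreover have "0 \<le> (real N * \<kappa> - (real N - p) / p) * (x * f x)"
      using Pohozaev_gap xf_pos[OF x] by simp
    ultimately show ?thesis by (simp add: algebra_simps)
  next
    case False
    then have "x \<in> {- (M / \<theta>)..M / \<theta>}" by auto
    then have "?H m \<le> ?H x" using m by blast
    then show ?thesis by linarith
  qed
  then show ?thesis by (intro exI[of _ "\<bar>?H m\<bar>"]) auto
qed

lemma Pohozaev_large:
  assumes l: "M / \<theta> \<le> l" and x: "\<theta> * l \<le> x" "x \<le> l"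
  shows "(real N * \<kappa> - (real N - p) / p) * (l * f l) \<le> real N * F x - (real N - p) / p * (x * f x)"
proof -
  have m: "M \<le> \<theta> * l" using l th by (simp add: divide_le_eq mult.commute)
  have lM: "M \<le> l" using l M_le_div by simp
  have "\<kappa> * (l * f l) \<le> F (\<theta> * l)" using F_ge[of l] lM M by auto
  also have "\<dots> \<le> F x" by (rule F_mono_pos[OF m x(1)])
  finally have 1: "real N * (\<kappa> * (l * f l)) \<le> real N * F x" by (intro mult_left_mono) auto
  have fx: "0 \<le> f x" using f_pos[of x] m x by (smt (verit) powr_ge_zero)
  have "f x \<le> f l" using monotone_onD[OF mono, of x l] m x lM by auto
  then have "x * f x \<le> l * f l" using fx x m M lM by (intro mult_mono) auto
  then have "(real N - p) / p * (x * f x) \<le> (real N - p) / p * (l * f l)"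
    using p by (intro mult_left_mono) auto
  then show ?thesis using 1 by (simp add: algebra_simps)
qed

text \<open>Zero energy means \<open>F x \<le> 0\<close>, which confines \<open>x\<close> to \<open>[- M, M]\<close> and then bounds \<open>w\<close>.\<close>

lemma zero_energy_bounded:
  "\<exists>C\<ge>0. \<forall>w x. \<bar>w\<bar> powr p / (p / (p - 1)) + F x = 0 \<longrightarrow> (real N - p) / p * \<bar>phi p w * x\<bar> \<le> C"
proof -
  obtain m where m: "m \<in> {- M..M}" "\<forall>x\<in>{- M..M}. F m \<le> F x"
    using continuous_attains_inf[of "{- M..M}" F] M contF by auto
  let ?C = "(p / (p - 1) * \<bar>F m\<bar>) powr ((p - 1) / p) * M"
  have "(real N - p) / p * \<bar>phi p w * x\<bar> \<le> (real N - p) / p * ?C"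
    if E: "\<bar>w\<bar> powr p / (p / (p - 1)) + F x = 0" for w x
  proof -
    have "F x \<le> 0" using E p by (smt (verit, best) divide_nonneg_pos powr_ge_zero zero_less_divide_iff)
    then have x: "\<bar>x\<bar> \<le> M" using F_pos[of x] by force
    then have "F m \<le> F x" using m by (auto simp: abs_le_iff)
    then have "\<bar>w\<bar> powr p / (p / (p - 1)) \<le> \<bar>F m\<bar>" using E by linarith
    then have "\<bar>w\<bar> powr p \<le> p / (p - 1) * \<bar>F m\<bar>"
      using p by (simp add: field_simps)
    then have "(\<bar>w\<bar> powr p) powr ((p - 1) / p) \<le> (p / (p - 1) * \<bar>F m\<bar>) powr ((p - 1) / p)"
      using p by (intro powr_mono2) auto
    then have "\<bar>phi p w\<bar> \<le> (p / (p - 1) * \<bar>F m\<bar>) powr ((p - 1) / p)"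
      using p by (simp add: abs_phi powr_powr)
    then show ?thesis using x p unfolding abs_mult by (intro mult_left_mono mult_mono) auto
  qed
  moreover have "0 \<le> (real N - p) / p * ?C" using p M by simp
  ultimately show ?thesis by blast
qed

text \<open>The lower bound for the radius, up to a constant factor. The exponent \<open>N p / (N - p) - 1\<close> is the
critical one.\<close>

definition rho :: "real \<Rightarrow> real" where
  "rho l = (l powr (real N * p / (real N - p) - 1) / f l) powr ((real N - p) / (real N * p))"

lemma f_large_pos: "M \<le> l \<Longrightarrow> 0 < f l"
  using xf_pos[of l] M by (auto simp: zero_less_mult_iff)

text \<open>The left-hand side is \<open>l f(l) R\<^sup>N\<close>, with \<open>R\<close> the length of the initial plateau in \<open>start_plateau\<close>.\<close>

lemma rho_power:
  assumes l: "M \<le> l"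
  shows "l * f l * ((((1 - \<theta>) * l) powr (p - 1) / f l) powr (1 / p)) ^ N
    = (1 - \<theta>) powr (real N * (p - 1) / p) * rho l ^ N"
proof -
  have l0: "l > 0" "f l > 0" using l M f_large_pos by auto
  have N0: "real N > 0" using p by simp
  have th': "1 - \<theta> > 0" using th by simp
  define g where "g = f l"
  define A B D where "A = ln l" and "B = ln g" and "D = ln (1 - \<theta>)"
  have e: "l = exp A" "g = exp B" "1 - \<theta> = exp D" using l0 th' by (auto simp: A_def B_def D_def g_def)
  have "l * f l * ((((1 - \<theta>) * l) powr (p - 1) / f l) powr (1 / p)) ^ N
     = exp (A + B + real N * ((1 / p) * ((p - 1) * (D + A) - B)))"
    unfolding g_def[symmetric] unfolding e by (simp add: powr_def flip: exp_of_nat_mult exp_diff exp_add)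
  also have "A + B + real N * ((1 / p) * ((p - 1) * (D + A) - B)) =
     real N * (p - 1) / p * D + real N * ((real N - p) / (real N * p) * ((real N * p / (real N - p) - 1) * A - B))"
    using p N0 by (simp add: field_simps)
  also have "exp \<dots> = (1 - \<theta>) powr (real N * (p - 1) / p) * rho l ^ N"
    unfolding rho_def g_def[symmetric] unfolding e by (simp add: powr_def flip: exp_of_nat_mult exp_diff exp_add)
  finally show ?thesis .
qed

text \<open>For large \<open>x\<close>, the inequality \<open>\<kappa> x F'(x) \<le> F(x)\<close> makes \<open>F(x) x\<^bsup>-1/\<kappa>\<^esup>\<close> nonincreasing, so \<open>f(x) = O(x\<^bsup>1/\<kappa>-1\<^esup>)\<close>, and
\<open>1 / \<kappa> < N p / (N - p)\<close>.\<close>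

lemma rho_at_top: "filterlim rho at_top at_top"
proof -
  define m where "m = M / \<theta>"
  have m: "m \<ge> M" "m > 0" using M_le_div M th by (auto simp: m_def)
  have kF: "\<kappa> * (x * f x) \<le> F x" if "m \<le> x" for x
    using F_ge[of x] F_scale[of x] that m M unfolding m_def by auto
  define C where "C = F m * m powr (- 1 / \<kappa>)"
  have "F m > 0" using F_pos[of m] m M by auto
  then have C: "C > 0" using m by (simp add: C_def)
  have Fle: "F x * x powr (- 1 / \<kappa>) \<le> C" if "m \<le> x" for x
    unfolding C_def
  proof (rule DERIV_nonpos_imp_nonincreasing[OF that])
    fix y assume y: "m \<le> y" "y \<le> x"
    then have y0: "y > 0" using m by simp
    have "((\<lambda>x. F x * x powr (- 1 / \<kappa>)) has_real_derivative
        f y * y powr (- 1 / \<kappa>) + (- 1 / \<kappa> * y powr (- 1 / \<kappa> - 1)) * F y) (at y)"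
      using y0 by (intro DERIV_mult F has_real_derivative_powr)
    moreover have "f y * y powr (- 1 / \<kappa>) + (- 1 / \<kappa> * y powr (- 1 / \<kappa> - 1)) * F y
        = y powr (- 1 / \<kappa> - 1) / \<kappa> * (\<kappa> * (y * f y) - F y)"
      using y0 kappa_pos powr_mult_base[of y "- 1 / \<kappa> - 1"] by (simp add: field_simps)
    moreover have "\<dots> \<le> 0"
      using kF[OF y(1)] kappa_pos by (intro mult_nonneg_nonpos) auto
    ultimately show "\<exists>d. ((\<lambda>x. F x * x powr (- 1 / \<kappa>)) has_real_derivative d) (at y) \<and> d \<le> 0" by metis
  qed
  define q where "q = real N * p / (real N - p)"
  have q: "1 / \<kappa> < q"
    using kappa p kappa_pos unfolding q_def by (simp add: field_simps)
  have lower: "\<kappa> / C * x powr (q - 1 / \<kappa>) \<le> x powr (q - 1) / f x" if x: "m \<le> x" for x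
  proof -
    have x0: "x > 0" "f x > 0" using x m f_large_pos[of x] by auto
    have "F x \<le> C * x powr (1 / \<kappa>)"
      using Fle[OF x] x0 by (simp add: powr_minus field_simps)
    then have 1: "\<kappa> * (x * f x) \<le> C * x powr (1 / \<kappa>)" using kF[OF x] by simp
    have "\<kappa> / C * x powr (q - 1 / \<kappa>) * f x = (\<kappa> * (x * f x)) * (x powr (q - 1 / \<kappa>) / (C * x))"
      using x0 C by (simp add: field_simps)
    also have "\<dots> \<le> (C * x powr (1 / \<kappa>)) * (x powr (q - 1 / \<kappa>) / (C * x))"
      using x0 C by (intro mult_right_mono 1) auto
    also have "\<dots> = (x powr (1 / \<kappa>) * x powr (q - 1 / \<kappa>)) / x" using x0 C by simp
    also have "x powr (1 / \<kappa>) * x powr (q - 1 / \<kappa>) = x powr q" by (simp flip: powr_add)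
    also have "x powr q / x = x powr (q - 1)" using x0 by (simp add: powr_diff)
    finally show ?thesis using x0 by (simp add: pos_le_divide_eq)
  qed
  have "filterlim (\<lambda>x. x powr (q - 1 / \<kappa>)) at_top at_top" using q by (intro filterlim_powr_at_top) auto
  then have "filterlim (\<lambda>x. \<kappa> / C * x powr (q - 1 / \<kappa>)) at_top at_top"
    using C kappa_pos by (intro filterlim_tendsto_pos_mult_at_top[OF tendsto_const]) auto
  then have "filterlim (\<lambda>x. x powr (q - 1) / f x) at_top at_top"
    using lower by (elim filterlim_at_top_mono) (auto simp: eventually_at_top_linorder)
  then show ?thesis
    unfolding rho_def q_def using p by (intro filterlim_compose[OF filterlim_powr_at_top]) auto
qed

text \<open>The quotient of the two sides is \<open>(l f(l))\<close> to a negative power, and \<open>l f(l) \<ge> 1\<close>.\<close>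

lemma bound_le_rho:
  assumes l: "M \<le> l"
  shows "(l powr (real N * (p - 1) / (real N - p)) / f l) powr ((real N - p) / (p * (real N - 1))) \<le> rho l"
proof -
  have l0: "l \<ge> 1" "f l > 0" using l M f_large_pos by auto
  have "1 \<le> l powr (p - 1)" using l0 p by (simp add: ge_one_powr_ge_zero)
  then have fl: "f l \<ge> 1" using f_pos[OF l] by simp
  have N1: "real N - 1 > 0" "real N > 0" using p by auto
  define g where "g = f l"
  define A B where "A = ln l" and "B = ln g"
  have e: "l = exp A" "g = exp B" using l0 by (auto simp: A_def B_def g_def)
  have AB: "A \<ge> 0" "B \<ge> 0" using l0 fl by (auto simp: A_def B_def g_def)
  have "(l powr (real N * (p - 1) / (real N - p)) / f l) powr ((real N - p) / (p * (real N - 1)))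
     = exp ((real N - p) / (p * (real N - 1)) * (real N * (p - 1) / (real N - p) * A - B))"
    unfolding g_def[symmetric] unfolding e by (simp add: powr_def flip: exp_diff)
  also have "(real N - p) / (p * (real N - 1)) * (real N * (p - 1) / (real N - p) * A - B)
    = (real N - p) / (real N * p) * ((real N * p / (real N - p) - 1) * A - B)
       - (real N - p) / (p * real N * (real N - 1)) * (A + B)"
    using p N1 by (simp add: divide_simps) (simp add: algebra_simps)
  also have "\<dots> \<le> (real N - p) / (real N * p) * ((real N * p / (real N - p) - 1) * A - B)"
    using AB p N1 by simp
  also have "exp \<dots> = rho l"
    unfolding rho_def g_def[symmetric] unfolding e by (simp add: powr_def flip: exp_diff)
  finally show ?thesis by simp
qed

end

context subcritical_nonlinearity begin

section \<open>Positivity of the energy\<close>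

text \<open>The constant \<open>c\<close> solves \<open>C c\<^sup>N = \<delta> \<eta>\<close>, so that the comparison of the two estimates of the Pohozaev
function at a zero \<open>y\<close> of the energy reads \<open>C (c rho(l))\<^sup>N \<le> N C1 y\<^bsup>N-1\<^esup> + C0 y\<^sup>N\<close>. As \<open>rho(l)\<close> is
large, this excludes \<open>y < 1\<close>, and for \<open>y \<ge> 1\<close> the right-hand side is at most \<open>C y\<^sup>N\<close>.\<close>

lemma energy_positive:
  "\<exists>c>0. \<exists>L. \<forall>l\<ge>L. \<forall>u v. radial_flow N p f u v \<longrightarrow> continuous_on {0..} u \<longrightarrow> continuous_on {0..} v \<longrightarrow>
     u 0 = l \<longrightarrow> v 0 = 0 \<longrightarrow>
     (\<forall>r. 0 \<le> r \<and> r < c * rho l \<longrightarrow> 0 < \<bar>v r\<bar> powr p / (p / (p - 1)) + F (u r))"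
proof -
  obtain C0 where C0: "C0 \<ge> 0" "\<And>x. - C0 \<le> real N * F x - (real N - p) / p * (x * f x)"
    using Pohozaev_bounded_below by blast
  obtain C1 where C1: "C1 \<ge> 0" "\<And>w x. \<bar>w\<bar> powr p / (p / (p - 1)) + F x = 0 \<Longrightarrow> (real N - p) / p * \<bar>phi p w * x\<bar> \<le> C1"
    using zero_energy_bounded by blast
  define \<delta> where "\<delta> = real N * \<kappa> - (real N - p) / p"
  define \<eta> where "\<eta> = (1 - \<theta>) powr (real N * (p - 1) / p)"
  define C where "C = real N * C1 + C0 + 1"
  have pos: "\<delta> > 0" "\<eta> > 0" "C > 0" "real N > 0"
    using Pohozaev_gap th C0 C1 p by (auto simp: \<delta>_def \<eta>_def C_def add_nonneg_pos)
  have N2: "2 \<le> N" "0 < N" using p by linarith+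
  define c where "c = (\<delta> * \<eta> / C) powr (1 / real N)"
  have c: "c > 0" using pos by (simp add: c_def)
  have cN: "C * c ^ N = \<delta> * \<eta>"
    unfolding c_def using pos by (simp add: powr_realpow[symmetric] powr_powr del: powr_realpow)
  have "\<forall>\<^sub>F l in at_top. 1 / c \<le> rho l" using rho_at_top by (auto simp: filterlim_at_top)
  then obtain L where L: "\<And>l. L \<le> l \<Longrightarrow> 1 / c \<le> rho l" by (auto simp: eventually_at_top_linorder)
  have main: "0 < \<bar>v r\<bar> powr p / (p / (p - 1)) + F (u r)"
    if l: "max L (M / \<theta>) \<le> l" and flow: "radial_flow N p f u v" and cu: "continuous_on {0..} u"
      and cv: "continuous_on {0..} v" and init: "u 0 = l" "v 0 = 0" and r: "0 \<le> r" "r < c * rho l"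
    for l u v r
  proof -
    let ?E = "\<lambda>r. \<bar>v r\<bar> powr p / (p / (p - 1)) + F (u r)"
    have lM: "M / \<theta> \<le> l" "M \<le> l" using l M_le_div by auto
    have l0: "l > 0" using lM M by simp
    have m: "M \<le> \<theta> * l" using lM th by (simp add: divide_le_eq mult.commute)
    have rho1: "1 \<le> c * rho l" using L[of l] l c by (simp add: divide_le_eq mult.commute)
    define R where "R = (((1 - \<theta>) * l) powr (p - 1) / f l) powr (1 / p)"
    have R0: "R > 0" unfolding R_def using th l0 f_large_pos[OF lM(2)] by simp
    have plateau: "\<theta> * l \<le> u y \<and> u y \<le> l" if "0 \<le> y" "y \<le> R" for y
      using start_plateau[OF p(1) N2(1) flow cu cv init l0 th, of y] mono m f_large_pos[OF m] f_large_pos[OF lM(2)]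
        that by (auto simp: R_def less_imp_le intro: mono_on_subset)
    have zero: "c * rho l \<le> y" if y: "0 \<le> y" and E0: "?E y = 0" for y
    proof -
      have Ry: "R \<le> y"
      proof (rule ccontr)
        assume "\<not> R \<le> y"
        then have "M \<le> u y" using plateau[of y] y m by simp
        then have "0 < F (u y)" using F_pos[of "u y"] M by simp
        moreover have "0 \<le> \<bar>v y\<bar> powr p / (p / (p - 1))" using p by simp
        ultimately show False using E0 by linarith
      qed
      have "\<delta> * (l * f l) * R ^ N / real N - C0 * y ^ N / real N
          \<le> y ^ N * ?E y + (real N - p) / p * (y ^ (N - 1) * phi p (v y)) * u y"
        using Ry R0 plateau lM C0 Pohozaev_large[OF lM(1)]
        by (intro Pohozaev_lower_bound[OF p(1) N2(2) flow F cu cv init(2)]) (auto simp: \<delta>_def)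
      also have "\<dots> = y ^ (N - 1) * ((real N - p) / p * (phi p (v y) * u y))"
        unfolding E0 by simp
      also have "\<dots> \<le> y ^ (N - 1) * C1"
      proof (rule mult_left_mono)
        have "(real N - p) / p * (phi p (v y) * u y) \<le> (real N - p) / p * \<bar>phi p (v y) * u y\<bar>"
          using p by (intro mult_left_mono) auto
        then show "(real N - p) / p * (phi p (v y) * u y) \<le> C1"
          using C1(2)[OF E0] by (rule order_trans)
      qed (use y in simp)
      finally have "\<delta> * (l * f l) * R ^ N \<le> real N * C1 * y ^ (N - 1) + C0 * y ^ N"
        using pos by (simp add: field_simps)
      moreover have "\<delta> * (l * f l) * R ^ N = \<delta> * (l * f l * R ^ N)" by simp
      moreover have "l * f l * R ^ N = \<eta> * rho l ^ N"
        unfolding R_def \<eta>_def by (rule rho_power[OF lM(2)])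
      ultimately have "\<delta> * \<eta> * rho l ^ N \<le> real N * C1 * y ^ (N - 1) + C0 * y ^ N" by simp
      then have bound: "C * (c * rho l) ^ N \<le> real N * C1 * y ^ (N - 1) + C0 * y ^ N"
        by (simp add: power_mult_distrib cN[symmetric] mult.assoc)
      have y1: "1 \<le> y"
      proof (rule ccontr)
        assume "\<not> 1 \<le> y"
        then have "y ^ (N - 1) \<le> 1" "y ^ N \<le> 1" using y by (auto intro!: power_le_one)
        then have "real N * C1 * y ^ (N - 1) + C0 * y ^ N \<le> real N * C1 * 1 + C0 * 1"
          using C0 C1 by (intro add_mono mult_left_mono) auto
        moreover have "C * 1 \<le> C * (c * rho l) ^ N"
          using rho1 pos by (intro mult_left_mono one_le_power) auto
        ultimately show False using bound by (simp add: C_def)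
      qed
      have "y ^ (N - 1) \<le> y ^ N" using y1 by (intro power_increasing) auto
      then have "real N * C1 * y ^ (N - 1) + C0 * y ^ N \<le> real N * C1 * y ^ N + C0 * y ^ N"
        using C1 by (intro add_right_mono mult_left_mono) auto
      also have "\<dots> \<le> C * y ^ N" using y by (simp add: C_def algebra_simps)
      finally have "C * (c * rho l) ^ N \<le> C * y ^ N" using bound by simp
      then have "(c * rho l) ^ N \<le> y ^ N" using pos by simp
      then show ?thesis using y N2 power_mono_iff[of "c * rho l" y N] rho1 by simp
    qed
    have contE: "continuous_on {0..r} ?E"
      using p by (intro continuous_intros continuous_on_powr' continuous_on_compose2[OF contF[of UNIV]]
          continuous_on_subset[OF cv] continuous_on_subset[OF cu]) auto
    show ?thesis
    proof (rule ccontr)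
      assume "\<not> ?thesis"
      moreover have "0 < ?E 0" using init p F_pos[of l] lM M by (auto intro!: add_nonneg_pos)
      ultimately obtain y where "0 \<le> y" "y \<le> r" "?E y = 0"
        using IVT2'[of ?E r 0 0] r contE by (auto simp: not_less)
      then show False using zero[of y] r by simp
    qed
  qed
  show ?thesis
    by (intro exI[of _ c] conjI c exI[of _ "max L (M / \<theta>)"]) (use main in blast)
qed

end

section \<open>Counting nodes\<close>

lemma changes_sign_at_simple_zero:
  assumes d: "(u has_real_derivative D) (at z)" and D: "D \<noteq> 0" and uz: "u z = 0"
  shows "changes_sign_at u z"
proof -
  have ev: "(\<forall>\<^sub>F r in at_left z. w r < 0) \<and> (\<forall>\<^sub>F r in at_right z. w r > 0)"
    if dw: "(w has_real_derivative D') (at z)" "D' > 0" and wz: "w z = 0" for w :: "real \<Rightarrow> real" and D'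
  proof
    obtain e where e: "e > 0" "\<And>h. 0 < h \<Longrightarrow> h < e \<Longrightarrow> w (z - h) < 0"
      using DERIV_pos_inc_left[OF dw] wz by auto
    show "\<forall>\<^sub>F r in at_left z. w r < 0"
      unfolding eventually_at_left_field
      by (intro exI[of _ "z - e"] conjI allI impI) (use e e(2)[of "z - _"] in auto)
    obtain e' where e': "e' > 0" "\<And>h. 0 < h \<Longrightarrow> h < e' \<Longrightarrow> w (z + h) > 0"
      using DERIV_pos_inc_right[OF dw] wz by auto
    show "\<forall>\<^sub>F r in at_right z. w r > 0"
      unfolding eventually_at_right_field
      by (intro exI[of _ "z + e'"] conjI allI impI) (use e' e'(2)[of "_ - z"] in auto)
  qed
  show ?thesis
  proof (cases "D > 0")
    case True
    then show ?thesis using ev[OF d] uz by (simp add: changes_sign_at_def)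
  next
    case False
    then show ?thesis using ev[OF DERIV_minus[OF d]] uz D by (simp add: changes_sign_at_def)
  qed
qed

lemma simple_zero_in_nodes:
  assumes d: "(u has_real_derivative D) (at z)" and D: "D \<noteq> 0" and uz: "u z = 0" and z: "0 < z"
  shows "z \<in> nodes u"
proof -
  have cs: "changes_sign_at u z" by (rule changes_sign_at_simple_zero[OF d D uz])
  then have "\<forall>\<^sub>F r in at_left z. u r \<noteq> 0" "\<forall>\<^sub>F r in at_right z. u r \<noteq> 0"
    unfolding changes_sign_at_def by (auto elim: eventually_mono)
  then have "\<forall>\<^sub>F r in at z. u r \<noteq> 0" by (simp add: eventually_at_split)
  moreover have "\<forall>\<^sub>F r in at z. 0 < r" using z by (intro order_tendstoD(1)[OF tendsto_ident_at])
  ultimately have ev: "\<forall>\<^sub>F r in at z. r \<in> {r. 0 \<le> r \<and> u r \<noteq> 0}" by eventually_elim auto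
  then obtain e where e: "e > 0" "\<And>r. r \<noteq> z \<Longrightarrow> dist r z < e \<Longrightarrow> r \<in> {r. 0 \<le> r \<and> u r \<noteq> 0}"
    by (auto simp: eventually_at)
  let ?S = "{r. 0 \<le> r \<and> u r \<noteq> 0}"
  have sub: "ball z e - {z} \<subseteq> ?S" using e(2) by (auto simp: dist_commute)
  have "z islimpt ?S"
    unfolding islimpt_iff_eventually
  proof
    assume "\<forall>\<^sub>F r in at z. r \<notin> ?S"
    with ev have "\<forall>\<^sub>F r in at z. False" by eventually_elim blast
    then show False by simp
  qed
  then have "ball z e \<subseteq> closure ?S" using sub closure_subset[of ?S] by (auto simp: closure_def)
  then have "z \<in> interior (closure ?S)" using e(1) by (meson centre_in_ball interior_maximal open_ball subsetD)
  then show ?thesis using cs uz by (simp add: nodes_def)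
qed

lemma card_ge_separated_intervals:
  fixes Z :: "real set"
  assumes Z: "finite Z" and T: "0 \<le> T" and hit: "\<And>k. k < n \<Longrightarrow> \<exists>z\<in>Z. s + real k * (T + 1) \<le> z \<and> z \<le> s + real k * (T + 1) + T"
  shows "n \<le> card Z"
proof -
  obtain z where z: "\<And>k. k < n \<Longrightarrow> z k \<in> Z \<and> s + real k * (T + 1) \<le> z k \<and> z k \<le> s + real k * (T + 1) + T"
    using hit by metis
  have less: "z j < z k" if "j < k" "k < n" for j k
  proof -
    have "(real j + 1) * (T + 1) \<le> real k * (T + 1)" using that T by (intro mult_right_mono) auto
    then show ?thesis using z[of j] z[of k] that by (simp add: algebra_simps)
  qed
  have "inj_on z {..<n}"
    by (rule inj_onI) (metis less lessThan_iff less_irrefl linorder_neqE_nat)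
  then show ?thesis using card_inj_on_le[of z "{..<n}" Z] z Z by auto
qed

section \<open>The primitive of the nonlinearity\<close>

lemma DERIV_primitive:
  assumes "continuous_on UNIV f"
  shows "(primitive f has_real_derivative f x) (at x)"
proof -
  define b where "b = \<bar>x\<bar> + 1"
  have "((\<lambda>u. LBINT y=0..ereal u. f y) has_vector_derivative f x) (at x within {- b..b})"
    using interval_integral_FTC2[of "- b" 0 b f x] continuous_on_subset[OF assms, of "{- b..b}"]
    by (auto simp: b_def zero_ereal_def)
  moreover have "at x within {- b..b} = at x" by (rule at_within_interior) (auto simp: b_def)
  ultimately show ?thesis
    by (simp add: has_real_derivative_iff_has_vector_derivative primitive_def[abs_def])
qed

lemma primitive_zero: "primitive f 0 = 0"
  by (simp add: primitive_def flip: zero_ereal_def)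

lemma subcritical_nonlinearity_primitive:
  assumes p_N: "1 < p" "p < real N" and cont: "continuous_on UNIV f"
    and mono: "\<exists>M. mono_on {M..} f"
    and superlinear: "Liminf at_infinity (\<lambda>u. ereal (f u / (\<bar>u\<bar> powr (p - 2) * u))) = \<infinity>"
    and th: "0 < \<theta>" "\<theta> < 1"
    and subcritical: "Liminf at_infinity (\<lambda>x. ereal (primitive f (\<theta> * x) / (x * f x)))
        > ereal ((real N - p) / (real N * p))"
  shows "\<exists>\<kappa> M. subcritical_nonlinearity N p f (primitive f) \<theta> \<kappa> M"
proof -
  obtain M0 where M0: "mono_on {M0..} f" using mono by blast
  have "ereal 1 < Liminf at_infinity (\<lambda>u. ereal (f u / (\<bar>u\<bar> powr (p - 2) * u)))"
    using superlinear by simp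
  from less_LiminfD[OF this] obtain M1 where M1: "\<And>u. M1 \<le> \<bar>u\<bar> \<Longrightarrow> 1 < f u / (\<bar>u\<bar> powr (p - 2) * u)"
    by (auto simp: eventually_at_infinity)
  obtain \<kappa> where k: "(real N - p) / (real N * p) < \<kappa>"
    "ereal \<kappa> < Liminf at_infinity (\<lambda>x. ereal (primitive f (\<theta> * x) / (x * f x)))"
    using ereal_dense2[OF subcritical] by auto
  from less_LiminfD[OF k(2)] obtain M2 where M2: "\<And>x. M2 \<le> \<bar>x\<bar> \<Longrightarrow> \<kappa> < primitive f (\<theta> * x) / (x * f x)"
    by (auto simp: eventually_at_infinity)
  define M where "M = max (max M0 M1) (max M2 1)"
  have fp: "x powr (p - 1) \<le> f x" if "M \<le> x" for x
  proof -
    have x: "M1 \<le> \<bar>x\<bar>" "0 < x" using that by (auto simp: M_def)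
    have "phi p x > 0" using x by (simp add: phi_zero_less_iff)
    then show ?thesis using M1[OF x(1)] x phi_nonneg_eq[of x p]
      unfolding phi_def[symmetric] by (simp add: less_divide_eq)
  qed
  have fn: "x powr (p - 1) \<le> - f (- x)" if "M \<le> x" for x
  proof -
    have x: "M1 \<le> \<bar>- x\<bar>" "0 < x" using that by (auto simp: M_def)
    have pos: "phi p x > 0" using x by (simp add: phi_zero_less_iff)
    have "1 < - f (- x) / phi p x" using M1[OF x(1)] unfolding phi_def[symmetric] by (simp add: phi_minus)
    then have "1 * phi p x < - f (- x)" unfolding pos_less_divide_eq[OF pos] .
    then show ?thesis using x phi_nonneg_eq[of x p] by simp
  qed
  have Fge: "\<kappa> * (x * f x) \<le> primitive f (\<theta> * x)" if "M \<le> \<bar>x\<bar>" for x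
  proof -
    have "0 < x * f x"
    proof (cases "0 \<le> x")
      case True
      then have "0 < x" using that by (auto simp: M_def)
      then have "0 < x powr (p - 1)" by simp
      also have "x powr (p - 1) \<le> f x" using that True by (intro fp) simp
      finally have "0 < f x" .
      then show ?thesis using \<open>0 < x\<close> by simp
    next
      case False
      then have "0 < (- x) powr (p - 1)" by simp
      also have "(- x) powr (p - 1) \<le> - f (- (- x))" using that False by (intro fn) simp
      finally have "f x < 0" by simp
      then show ?thesis using False by (simp add: mult_neg_neg)
    qed
    moreover have "\<kappa> < primitive f (\<theta> * x) / (x * f x)" using that by (intro M2) (simp add: M_def)
    ultimately show ?thesis by (simp only: less_divide_eq if_True less_imp_le)
  qed
  have "mono_on {M..} f" using M0 by (rule mono_on_subset) (auto simp: M_def)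
  then have "subcritical_nonlinearity N p f (primitive f) \<theta> \<kappa> M"
    using p_N cont DERIV_primitive[OF cont] primitive_zero th k(1) fp fn Fge
    by unfold_locales (auto simp: M_def)
  then show ?thesis by blast
qed

section \<open>Lower bounds for the radius and the number of nodes\<close>

lemma zero_energy_radius_ge:
  assumes "\<And>r. 0 \<le> r \<Longrightarrow> r < \<rho> \<Longrightarrow> 0 < energy p f u r"
  shows "ereal \<rho> \<le> zero_energy_radius p f u"
  unfolding zero_energy_radius_def
proof (rule Inf_greatest)
  fix x assume "x \<in> {ereal r |r. 0 \<le> r \<and> energy p f u r = 0}"
  then obtain r where r: "x = ereal r" "0 \<le> r" "energy p f u r = 0" by blast
  then show "ereal \<rho> \<le> x" using assms[of r] by (cases "r < \<rho>") auto
qed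

lemma node_count_ge:
  assumes p: "1 < p" and sol: "radial_solution N p f l u"
    and E: "\<And>r. 0 \<le> r \<Longrightarrow> r < \<rho> \<Longrightarrow> 0 < energy p f u r"
    and T: "0 \<le> T" and s: "0 < s" and n: "s + real n * (T + 1) \<le> \<rho>"
    and hit: "\<And>t. s \<le> t \<Longrightarrow> t + T < \<rho> \<Longrightarrow> \<exists>z\<in>{t..t + T}. u z = 0"
  shows "ereal (real n) \<le> node_count p f u"
proof -
  define Z where "Z = {z \<in> nodes u. 0 \<le> z \<and> ereal z < zero_energy_radius p f u}"
  have inZ: "z \<in> Z" if z: "0 < z" "z < \<rho>" "u z = 0" for z
  proof -
    have "(u has_real_derivative rderiv u z) (at z)"
      using radial_flow_DERIV(1)[OF radial_solution_flow(1)[OF sol]] z by blast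
    moreover have "rderiv u z \<noteq> 0"
      using E[of z] z p by (auto simp: energy_def primitive_zero)
    ultimately have "z \<in> nodes u" using z by (intro simple_zero_in_nodes)
    moreover have "ereal z < zero_energy_radius p f u"
      using zero_energy_radius_ge[of \<rho>, OF E] z by (auto intro: less_le_trans[of _ "ereal \<rho>"])
    ultimately show ?thesis using z by (simp add: Z_def)
  qed
  have "n \<le> card Z" if "finite Z"
  proof (rule card_ge_separated_intervals[OF that T])
    fix k assume "k < n"
    then have "(real k + 1) * (T + 1) \<le> real n * (T + 1)" using T by (intro mult_right_mono) auto
    then have less: "s + real k * (T + 1) + T < \<rho>" using n by (simp add: algebra_simps)
    have ge: "0 \<le> real k * (T + 1)" using T by simp
    obtain z where z: "s + real k * (T + 1) \<le> z" "z \<le> s + real k * (T + 1) + T" "u z = 0"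
      using hit[OF _ less] ge by auto
    moreover have "z \<in> Z" by (rule inZ[OF _ _ z(3)]) (use z less s ge in linarith)+
    ultimately show "\<exists>z\<in>Z. s + real k * (T + 1) \<le> z \<and> z \<le> s + real k * (T + 1) + T" by blast
  qed
  then show ?thesis unfolding node_count_def Let_def Z_def[symmetric] by simp
qed

lemma nat_floor_ge_half:
  fixes T s \<rho> :: real
  assumes T: "0 \<le> T" and \<rho>: "2 * (s + T + 1) \<le> \<rho>" and s: "0 \<le> s"
  shows "\<exists>n. s + real n * (T + 1) \<le> \<rho> \<and> \<rho> / (2 * (T + 1)) \<le> real n"
proof -
  define x where "x = (\<rho> - s) / (T + 1)"
  have x: "x \<ge> 0" using assms by (simp add: x_def)
  have xT: "x * (T + 1) = \<rho> - s" using T by (simp add: x_def)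
  have "real (nat \<lfloor>x\<rfloor>) * (T + 1) \<le> x * (T + 1)"
    using x T by (intro mult_right_mono) auto
  then have 1: "s + real (nat \<lfloor>x\<rfloor>) * (T + 1) \<le> \<rho>" using xT by simp
  have "x - 1 \<le> real (nat \<lfloor>x\<rfloor>)" using x by linarith
  moreover have "\<rho> / (2 * (T + 1)) \<le> x - 1"
  proof -
    have "\<rho> / 2 \<le> (x - 1) * (T + 1)" using \<rho> xT by (simp add: algebra_simps)
    then show ?thesis using T by (simp add: divide_simps) (simp add: algebra_simps)
  qed
  ultimately show ?thesis using 1 by (intro exI[of _ "nat \<lfloor>x\<rfloor>"]) linarith
qed

theorem proposition6p1:
  fixes N :: nat and p :: real and f :: "real \<Rightarrow> real"
  assumes p_N: "1 < p" "p < real N"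
    and H1: "continuous_on UNIV f"
      "\<forall>x. x \<noteq> 0 \<longrightarrow> (\<exists>e>0. \<exists>L. L-lipschitz_on (ball x e \<inter> - {0}) f)"
      "f 0 = 0"
    and H2: "\<exists>a b. b < 0 \<and> 0 < a \<and>
      (\<forall>x y. b < x \<and> x < y \<and> y < a \<longrightarrow> f y < f x) \<and>
      (\<forall>\<^sub>F x in nhds a. f a \<le> f x) \<and> (\<forall>\<^sub>F x in nhds b. f x \<le> f b)"
    and H3: "locally_integrable_inverse_root p (primitive f) 0"
      "\<forall>x0. x0 \<noteq> 0 \<and> (\<forall>\<^sub>F u in nhds x0. primitive f u \<le> primitive f x0) \<longrightarrow>
        locally_integrable_inverse_root p (\<lambda>u. primitive f x0 - primitive f u) x0"
    and H4: "\<forall>u0. u0 \<noteq> 0 \<and> f u0 = 0 \<longrightarrow> primitive f u0 < 0"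
    and H5: "\<exists>M. mono_on {M..} f"
      "Liminf at_infinity (\<lambda>u. ereal (f u / (\<bar>u\<bar> powr (p - 2) * u))) = \<infinity>"
    and H6: "\<exists>\<theta>. 0 < \<theta> \<and> \<theta> < 1 \<and>
      Liminf at_infinity (\<lambda>x. ereal (primitive f (\<theta> * x) / (x * f x)))
        > ereal ((real N - p) / (real N * p)) \<and>
      (real N - p) / (real N * p) > 0"
  shows
    "(\<exists>C>0. \<forall>\<^sub>F l in at_top. \<forall>u. radial_solution N p f l u \<longrightarrow>
        ereal (C * (l powr (real N * (p - 1) / (real N - p)) / f l)
                     powr ((real N - p) / (p * (real N - 1))))
          \<le> zero_energy_radius p f u \<and>
        ereal (C * (l powr (real N * (p - 1) / (real N - p)) / f l)
                     powr ((real N - p) / (p * (real N - 1))))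
          \<le> node_count p f u) \<and>
     (filterlim (\<lambda>l. l powr (real N * (p - 1) / (real N - p)) / f l) at_top at_top \<longrightarrow>
        (\<forall>u. (\<forall>\<^sub>F l in at_top. radial_solution N p f l (u l)) \<longrightarrow>
           ((\<lambda>l. zero_energy_radius p f (u l)) \<longlongrightarrow> \<infinity>) at_top \<and>
           ((\<lambda>l. node_count p f (u l)) \<longlongrightarrow> \<infinity>) at_top))"
proof -
  define X where "X = (\<lambda>l. l powr (real N * (p - 1) / (real N - p)) / f l)"
  define \<beta> where "\<beta> = (real N - p) / (p * (real N - 1))"
  obtain \<theta> where th: "0 < \<theta>" "\<theta> < 1" "Liminf at_infinity (\<lambda>x. ereal (primitive f (\<theta> * x) / (x * f x)))
        > ereal ((real N - p) / (real N * p))"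
    using H6 by blast
  obtain \<kappa> M where sub: "subcritical_nonlinearity N p f (primitive f) \<theta> \<kappa> M"
    using subcritical_nonlinearity_primitive[OF p_N H1(1) H5 th] by blast
  interpret subcritical_nonlinearity N p f "primitive f" \<theta> \<kappa> M by (rule sub)
  obtain a b where ab: "b < 0" "0 < a" "\<And>x y. b < x \<Longrightarrow> x < y \<Longrightarrow> y < a \<Longrightarrow> f y < f x"
    using H2 by blast
  have neg: "\<exists>x>0. f x < 0" "\<exists>x<0. f x > 0"
    using ab(3)[of 0 "a / 2"] ab(3)[of "b / 2" 0] ab(1,2) H1(3)
    by (auto intro: exI[of _ "a / 2"] exI[of _ "b / 2"])
  obtain e where e: "e > 0"
    "(\<integral>\<^sup>+x\<in>{- e<..<e}. inverse (ennreal (\<bar>primitive f x\<bar> powr (1 / p))) \<partial>lborel) < \<infinity>"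
    using H3(1) by (auto simp: locally_integrable_inverse_root_def)
  have large: "\<exists>M. \<forall>x\<ge>M. x powr (p - 1) \<le> f x" "\<exists>M. \<forall>x\<ge>M. x powr (p - 1) \<le> - f (- x)"
    using f_pos f_neg by blast+
  from oscillation[OF p_N(1) H1(1) DERIV_primitive[OF H1(1)] primitive_zero neg H4 large e, of N]
  obtain T s where T: "T > 0" "s \<ge> 1" and osc: "\<forall>u v. \<forall>t\<ge>s. radial_flow N p f u v \<longrightarrow>
    (\<forall>r\<in>{t..t + T}. 0 < \<bar>v r\<bar> powr p / (p / (p - 1)) + primitive f (u r)) \<longrightarrow> (\<exists>z\<in>{t..t + T}. u z = 0)"
    by (elim exE conjE)
  obtain c L where c: "c > 0" and pos: "\<forall>l\<ge>L. \<forall>u v. radial_flow N p f u v \<longrightarrow> continuous_on {0..} u \<longrightarrow>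
     continuous_on {0..} v \<longrightarrow> u 0 = l \<longrightarrow> v 0 = 0 \<longrightarrow>
     (\<forall>r. 0 \<le> r \<and> r < c * rho l \<longrightarrow> 0 < \<bar>v r\<bar> powr p / (p / (p - 1)) + primitive f (u r))"
    using energy_positive by (elim exE conjE)
  define C where "C = c / (2 * (T + 1))"
  have C: "0 < C" "C \<le> c" using c T by (auto simp: C_def field_simps)
  have bound: "ereal (C * X l powr \<beta>) \<le> zero_energy_radius p f u \<and> ereal (C * X l powr \<beta>) \<le> node_count p f u"
    if l: "L \<le> l" "M \<le> l" "2 * (s + T + 1) / c \<le> rho l" and sol: "radial_solution N p f l u" for l u
  proof -
    have E: "0 < energy p f u r" if "0 \<le> r" "r < c * rho l" for r
      using pos l(1) radial_solution_flow[OF sol] that unfolding energy_def by blast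
    have Xrho: "X l powr \<beta> \<le> rho l" unfolding X_def \<beta>_def by (rule bound_le_rho[OF l(2)])
    have rho0: "0 \<le> rho l" using Xrho powr_ge_zero[of "X l" \<beta>] by linarith
    have "C * X l powr \<beta> \<le> c * rho l" using C Xrho rho0 c by (intro mult_mono) auto
    moreover have "ereal (c * rho l) \<le> zero_energy_radius p f u" by (rule zero_energy_radius_ge[OF E])
    ultimately have 1: "ereal (C * X l powr \<beta>) \<le> zero_energy_radius p f u"
      by (meson ereal_less_eq(3) order_trans)
    have "2 * (s + T + 1) \<le> c * rho l" using l(3) c by (simp add: pos_divide_le_eq mult.commute)
    then obtain n where n: "s + real n * (T + 1) \<le> c * rho l" "c * rho l / (2 * (T + 1)) \<le> real n"
      using nat_floor_ge_half[of T s "c * rho l"] T by auto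
    have "ereal (real n) \<le> node_count p f u"
    proof (rule node_count_ge[OF p_N(1) sol E _ _ n(1)])
      fix t assume t: "s \<le> t" "t + T < c * rho l"
      have "\<forall>r\<in>{t..t + T}. 0 < \<bar>rderiv u r\<bar> powr p / (p / (p - 1)) + primitive f (u r)"
        using E t T unfolding energy_def by auto
      then show "\<exists>z\<in>{t..t + T}. u z = 0" using osc t(1) radial_solution_flow(1)[OF sol] by blast
    qed (use T in auto)
    moreover have "C * X l powr \<beta> \<le> real n"
    proof -
      have "C * X l powr \<beta> \<le> C * rho l" using C Xrho by (intro mult_left_mono) auto
      also have "\<dots> = c * rho l / (2 * (T + 1))" by (simp add: C_def)
      finally show ?thesis using n(2) by linarith
    qed
    ultimately have "ereal (C * X l powr \<beta>) \<le> node_count p f u"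
      by (meson ereal_less_eq(3) order_trans)
    with 1 show ?thesis by blast
  qed
  have "\<forall>\<^sub>F l in at_top. 2 * (s + T + 1) / c \<le> rho l" using rho_at_top by (auto simp: filterlim_at_top)
  then have ev: "\<forall>\<^sub>F l in at_top. \<forall>u. radial_solution N p f l u \<longrightarrow>
      ereal (C * X l powr \<beta>) \<le> zero_energy_radius p f u \<and> ereal (C * X l powr \<beta>) \<le> node_count p f u"
    using eventually_ge_at_top[of L] eventually_ge_at_top[of M] by eventually_elim (use bound in blast)
  have lim: "((\<lambda>l. zero_energy_radius p f (u l)) \<longlongrightarrow> \<infinity>) at_top \<and> ((\<lambda>l. node_count p f (u l)) \<longlongrightarrow> \<infinity>) at_top"
    if X: "filterlim X at_top at_top" and sol: "\<forall>\<^sub>F l in at_top. radial_solution N p f l (u l)" for u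
  proof -
    have "\<beta> > 0" using p_N by (simp add: \<beta>_def)
    then have "filterlim (\<lambda>l. C * X l powr \<beta>) at_top at_top"
      using C by (intro filterlim_tendsto_pos_mult_at_top[OF tendsto_const]
          filterlim_compose[OF filterlim_powr_at_top X])
    then have "((\<lambda>l. ereal (C * X l powr \<beta>)) \<longlongrightarrow> \<infinity>) at_top" by (simp add: tendsto_PInfty_eq_at_top)
    then have large: "\<forall>\<^sub>F l in at_top. ereal r < ereal (C * X l powr \<beta>)" for r
      unfolding tendsto_PInfty by blast
    have "\<forall>\<^sub>F l in at_top. ereal r < zero_energy_radius p f (u l)" for r
      using large[of r] ev sol by eventually_elim (meson less_le_trans)
    moreover have "\<forall>\<^sub>F l in at_top. ereal r < node_count p f (u l)" for r
      using large[of r] ev sol by eventually_elim (meson less_le_trans)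
    ultimately show ?thesis unfolding tendsto_PInfty by blast
  qed
  show ?thesis
    unfolding X_def[symmetric] \<beta>_def[symmetric] using C(1) ev lim unfolding X_def by blast
qed

end
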